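(* Let $V:L^2([0,1])\to L^2([0,1])$ be a unitary operator (boundary unitary) and let $P_V$ be the associated selfadjoint extension of $P_{\min}$ in $L^2([0,1]^2)$. Then the spectrum of $P_V$ equals the set of $\lambda\in\mathbb{R}$ for which $e(\lambda)$ is in the spectrum of $V$.
   Context: All Hilbert spaces are complex, and $e(r):=e^{i2\pi r}$. In $L^2([0,1]^2)$ let $P_{\min}=\frac{1}{i2\pi}\partial_x$ be the symmetric operator with domain the smooth functions compactly supported in the open unit square. Its adjoint is $P_{\max}=\frac{1}{i2\pi}\partial_x$ (distributional derivative) with domain $\{f\in L^2([0,1]^2)\mid \partial_x f\in L^2([0,1]^2)\}$. For $f\in\mathrm{dom}(P_{\max})$ the boundary values $f(0,\cdot),f(1,\cdot)$ are well-defined elements of $L^2([0,1])$. For a unitary operator $V$ on $L^2([0,1])$, $P_V$ denotes the restriction of $P_{\max}$ to the domain $\{f\in\mathrm{dom}(P_{\max})\mid f(1,\cdot)=Vf(0,\cdot)\}$; it is a selfadjoint extension of $P_{\min}$. *)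

theory Defs
  imports "HOL-Analysis.Analysis"
begin

section \<open>Complex inner product spaces\<close>

class scaleC =
  fixes scaleC :: "complex \<Rightarrow> 'a \<Rightarrow> 'a"  (infixr \<open>*\<^sub>C\<close> 75)

text \<open>
  The inner product is conjugate linear in the first argument; its real part is the library's real
  inner product, so that norm and topology are those of \<^class>\<open>real_inner\<close>.
\<close>

class complex_inner = real_inner + scaleC +
  fixes cinner :: "'a \<Rightarrow> 'a \<Rightarrow> complex"
  assumes scaleC_add_right: "c *\<^sub>C (x + y) = c *\<^sub>C x + c *\<^sub>C y"
    and scaleC_add_left: "(c + d) *\<^sub>C x = c *\<^sub>C x + d *\<^sub>C x"
    and scaleC_scaleC: "c *\<^sub>C (d *\<^sub>C x) = (c * d) *\<^sub>C x"
    and scaleC_one: "1 *\<^sub>C x = x"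
    and scaleR_scaleC: "scaleR r x = complex_of_real r *\<^sub>C x"
    and cinner_commute: "cinner x y = cnj (cinner y x)"
    and cinner_add_right: "cinner x (y + z) = cinner x y + cinner x z"
    and cinner_scaleC_right: "cinner x (c *\<^sub>C y) = c * cinner x y"
    and inner_eq_Re_cinner: "inner x y = Re (cinner x y)"

definition unitary :: "('a::complex_inner \<Rightarrow> 'b::complex_inner) \<Rightarrow> bool" where
  "unitary V \<longleftrightarrow>
     Vector_Spaces.linear scaleC scaleC V \<and> surj V \<and>
     (\<forall>f g. cinner (V f) (V g) = cinner f g)"


section \<open>Unbounded operators and their spectrum\<close>

text \<open>
  An operator is a domain together with a map; only the values of the map on the domain matter.
\<close>

type_synonym 'a operator = "'a set \<times> ('a \<Rightarrow> 'a)"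

definition resolvent_set :: "'a::complex_inner operator \<Rightarrow> complex set" where
  "resolvent_set = (\<lambda>(D, T). {z.
     bij_betw (\<lambda>f. T f - z *\<^sub>C f) D UNIV \<and>
     (\<exists>B. \<forall>f\<in>D. norm f \<le> B * norm (T f - z *\<^sub>C f))})"

definition spectrum :: "'a::complex_inner operator \<Rightarrow> complex set" where
  "spectrum T = - resolvent_set T"


section \<open>The Hilbert space of square integrable functions on the unit cube\<close>

definition unit_cube_measure :: "'a::euclidean_space measure" where
  "unit_cube_measure = restrict_space lborel (cbox 0 One)"

lemma unit_cube_real: "cbox 0 One = {0..1::real}"
  by simp

lemma unit_cube_prod: "cbox 0 One = {0..1::real} \<times> {0..1::real}"
proof -
  have "(One :: real \<times> real) = (1, 1)"
    by (rule euclidean_eqI) (auto simp: Basis_prod_def)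
  then show ?thesis
    by (simp add: zero_prod_def cbox_Pair_eq)
qed

definition square_integrable :: "('a::euclidean_space \<Rightarrow> complex) \<Rightarrow> bool" where
  "square_integrable f \<longleftrightarrow>
     f \<in> borel_measurable unit_cube_measure \<and>
     integrable unit_cube_measure (\<lambda>x. (cmod (f x))\<^sup>2)"

definition L2_rel :: "('a::euclidean_space \<Rightarrow> complex) \<Rightarrow> ('a \<Rightarrow> complex) \<Rightarrow> bool" where
  "L2_rel f g \<longleftrightarrow>
     square_integrable f \<and> square_integrable g \<and> (AE x in unit_cube_measure. f x = g x)"

lemma square_integrable_zero: "square_integrable (\<lambda>_. 0)"
  by (simp add: square_integrable_def)

lemma square_integrable_scaleC: "square_integrable f \<Longrightarrow> square_integrable (\<lambda>x. c * f x)"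
  by (auto simp: square_integrable_def norm_mult power_mult_distrib)

lemma square_integrable_add:
  assumes f: "square_integrable f" and g: "square_integrable g"
  shows "square_integrable (\<lambda>x. f x + g x)"
proof -
  have [measurable]: "f \<in> borel_measurable unit_cube_measure" "g \<in> borel_measurable unit_cube_measure"
    using f g by (auto simp: square_integrable_def)
  have bound: "(cmod (a + b))\<^sup>2 \<le> 2 * (cmod a)\<^sup>2 + 2 * (cmod b)\<^sup>2" for a b
  proof -
    have "(cmod (a + b))\<^sup>2 \<le> (cmod a + cmod b)\<^sup>2"
      by (intro power_mono norm_triangle_ineq) auto
    also have "\<dots> \<le> 2 * (cmod a)\<^sup>2 + 2 * (cmod b)\<^sup>2"
      using sum_squares_bound[of "cmod a" "cmod b"] by (simp add: power2_sum)
    finally show ?thesis .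
  qed
  have "integrable unit_cube_measure (\<lambda>x. 2 * (cmod (f x))\<^sup>2 + 2 * (cmod (g x))\<^sup>2)"
    using f g by (auto simp: square_integrable_def)
  then have "integrable unit_cube_measure (\<lambda>x. (cmod (f x + g x))\<^sup>2)"
    by (rule Bochner_Integration.integrable_bound) (use bound in auto)
  then show ?thesis
    by (simp add: square_integrable_def)
qed

lemma borel_measurable_cnj [measurable]: "cnj \<in> borel_measurable borel"
  by (intro borel_measurable_continuous_onI continuous_intros)

lemma integrable_cnj_mult:
  assumes f: "square_integrable f" and g: "square_integrable g"
  shows "integrable unit_cube_measure (\<lambda>x. cnj (f x) * g x)"
proof -
  have [measurable]: "f \<in> borel_measurable unit_cube_measure" "g \<in> borel_measurable unit_cube_measure"
    using f g by (auto simp: square_integrable_def)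
  have bound: "cmod a * cmod b \<le> (cmod a)\<^sup>2 + (cmod b)\<^sup>2" for a b
  proof -
    have "0 \<le> (cmod a)\<^sup>2" "0 \<le> (cmod b)\<^sup>2"
      by auto
    then show ?thesis
      using sum_squares_bound[of "cmod a" "cmod b"] by linarith
  qed
  have "integrable unit_cube_measure (\<lambda>x. (cmod (f x))\<^sup>2 + (cmod (g x))\<^sup>2)"
    using f g by (auto simp: square_integrable_def)
  then show ?thesis
    by (rule Bochner_Integration.integrable_bound) (use bound in \<open>auto simp: norm_mult\<close>)
qed

lemma integral_cnj_mult_self:
  "integral\<^sup>L M (\<lambda>x. cnj (f x) * f x) = complex_of_real (integral\<^sup>L M (\<lambda>x. (cmod (f x))\<^sup>2))"
proof -
  have "cnj (f x) * f x = complex_of_real ((cmod (f x))\<^sup>2)" for x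
    by (metis complex_norm_square mult.commute)
  then show ?thesis
    by (simp only: integral_complex_of_real)
qed

quotient_type (overloaded) 'a L2 = "'a::euclidean_space \<Rightarrow> complex" / partial: L2_rel
proof (rule part_equivpI)
  show "\<exists>f::'a \<Rightarrow> complex. L2_rel f f"
    using square_integrable_zero by (auto simp: L2_rel_def)
  show "symp (L2_rel :: ('a \<Rightarrow> complex) \<Rightarrow> _)"
    by (auto simp: symp_def L2_rel_def elim: eventually_mono)
  show "transp (L2_rel :: ('a \<Rightarrow> complex) \<Rightarrow> _)"
    by (auto simp: transp_def L2_rel_def)
qed

instantiation L2 :: (euclidean_space) complex_inner
begin

lift_definition zero_L2 :: "'a L2" is "\<lambda>_. 0"
  by (simp add: L2_rel_def square_integrable_zero)

lift_definition plus_L2 :: "'a L2 \<Rightarrow> 'a L2 \<Rightarrow> 'a L2" is "\<lambda>f g x. f x + g x"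
  by (auto simp: L2_rel_def intro: square_integrable_add)

lift_definition scaleC_L2 :: "complex \<Rightarrow> 'a L2 \<Rightarrow> 'a L2" is "\<lambda>c f x. c * f x"
  by (auto simp: L2_rel_def intro: square_integrable_scaleC)

lift_definition cinner_L2 :: "'a L2 \<Rightarrow> 'a L2 \<Rightarrow> complex" is
  "\<lambda>f g. integral\<^sup>L unit_cube_measure (\<lambda>x. cnj (f x) * g x)"
  by (rule integral_cong_AE)
     (auto simp: L2_rel_def square_integrable_def)

definition uminus_L2 :: "'a L2 \<Rightarrow> 'a L2" where
  "uminus_L2 f = (-1) *\<^sub>C f"

definition minus_L2 :: "'a L2 \<Rightarrow> 'a L2 \<Rightarrow> 'a L2" where
  "minus_L2 f g = f + (- g)"

definition scaleR_L2 :: "real \<Rightarrow> 'a L2 \<Rightarrow> 'a L2" where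
  "scaleR_L2 r f = complex_of_real r *\<^sub>C f"

definition inner_L2 :: "'a L2 \<Rightarrow> 'a L2 \<Rightarrow> real" where
  "inner_L2 f g = Re (cinner f g)"

definition norm_L2 :: "'a L2 \<Rightarrow> real" where
  "norm_L2 f = sqrt (inner f f)"

definition sgn_L2 :: "'a L2 \<Rightarrow> 'a L2" where
  "sgn_L2 f = complex_of_real (inverse (norm f)) *\<^sub>C f"

definition dist_L2 :: "'a L2 \<Rightarrow> 'a L2 \<Rightarrow> real" where
  "dist_L2 f g = norm (f - g)"

definition uniformity_L2 :: "('a L2 \<times> 'a L2) filter" where
  "uniformity_L2 = (INF e\<in>{0<..}. principal {(f, g). dist f g < e})"

definition open_L2 :: "'a L2 set \<Rightarrow> bool" where
  "open_L2 U \<longleftrightarrow> (\<forall>f\<in>U. \<forall>\<^sub>F (f', g) in uniformity. f' = f \<longrightarrow> g \<in> U)"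

instance
proof
  fix f g h :: "'a L2" and a b :: real and c d :: complex
  show add_assoc: "f + g + h = f + (g + h)" for f g h :: "'a L2"
    by transfer (auto simp: L2_rel_def add.assoc intro!: square_integrable_add)
  show add_comm: "f + g = g + f" for f g :: "'a L2"
    by transfer (auto simp: L2_rel_def add.commute intro!: square_integrable_add)
  show "0 + f = f"
    by transfer (auto simp: L2_rel_def)
  show "- f + f = 0"
    unfolding uminus_L2_def
    by transfer (auto simp: L2_rel_def square_integrable_zero)
  show "f - g = f + - g"
    by (simp add: minus_L2_def)
  show C1: "c *\<^sub>C (f + g) = c *\<^sub>C f + c *\<^sub>C g" for c and f g :: "'a L2"
    by transfer (auto simp: L2_rel_def ring_distribs intro!: square_integrable_add square_integrable_scaleC)
  show C2: "(c + d) *\<^sub>C f = c *\<^sub>C f + d *\<^sub>C f" for c d and f :: "'a L2"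
    by transfer (auto simp: L2_rel_def ring_distribs intro!: square_integrable_add square_integrable_scaleC)
  show C3: "c *\<^sub>C (d *\<^sub>C f) = (c * d) *\<^sub>C f" for c d and f :: "'a L2"
    by transfer (auto simp: L2_rel_def mult.assoc
        intro!: square_integrable_scaleC[where c = "_ * _", unfolded mult.assoc])
  show C4: "1 *\<^sub>C f = f" for f :: "'a L2"
    by transfer (auto simp: L2_rel_def)
  show "a *\<^sub>R (f + g) = a *\<^sub>R f + a *\<^sub>R g"
    by (simp add: scaleR_L2_def C1)
  show "(a + b) *\<^sub>R f = a *\<^sub>R f + b *\<^sub>R f"
    by (simp add: scaleR_L2_def C2)
  show "a *\<^sub>R b *\<^sub>R f = (a * b) *\<^sub>R f"
    by (simp add: scaleR_L2_def C3)
  show "1 *\<^sub>R f = f"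
    by (simp add: scaleR_L2_def C4)
  show "a *\<^sub>R f = complex_of_real a *\<^sub>C f"
    by (simp add: scaleR_L2_def)
  show I1: "cinner f g = cnj (cinner g f)" for f g :: "'a L2"
  proof transfer
    fix f g :: "'a \<Rightarrow> complex"
    show "integral\<^sup>L unit_cube_measure (\<lambda>x. cnj (f x) * g x) =
          cnj (integral\<^sup>L unit_cube_measure (\<lambda>x. cnj (g x) * f x))"
      by (subst Bochner_Integration.integral_cnj[symmetric]) (simp add: mult.commute)
  qed
  show I2: "cinner f (g + h) = cinner f g + cinner f h" for f g h :: "'a L2"
    by transfer (simp add: L2_rel_def ring_distribs integrable_cnj_mult)
  show I3: "cinner f (c *\<^sub>C g) = c * cinner f g" for c and f g :: "'a L2"
    by transfer (simp add: L2_rel_def mult.left_commute[of "cnj _"])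
  show "inner f g = Re (cinner f g)"
    by (simp add: inner_L2_def)
  show "inner f g = inner g f"
    by (simp add: inner_L2_def I1[of f g])
  show "inner (f + g) h = inner f h + inner g h"
    by (simp add: inner_L2_def I1[of _ h] I2)
  show "inner (a *\<^sub>R f) g = a * inner f g"
    by (simp add: inner_L2_def I1[of _ g] I3 scaleR_L2_def)
  show "0 \<le> inner f f"
    unfolding inner_L2_def by transfer (simp add: integral_cnj_mult_self)
  show "inner f f = 0 \<longleftrightarrow> f = 0"
    unfolding inner_L2_def
    by transfer (auto simp: integral_cnj_mult_self L2_rel_def square_integrable_zero
        square_integrable_def integral_nonneg_eq_0_iff_AE)
  show "norm f = sqrt (inner f f)"
    by (simp add: norm_L2_def)
  show "sgn f = inverse (norm f) *\<^sub>R f"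
    by (simp add: sgn_L2_def scaleR_L2_def)
  show "dist f g = norm (f - g)"
    by (simp add: dist_L2_def)
  show "uniformity = (INF e\<in>{0<..}. principal {(x::'a L2, y). dist x y < e})"
    by (simp add: uniformity_L2_def)
  show "open U \<longleftrightarrow> (\<forall>x\<in>U. \<forall>\<^sub>F (x', y) in uniformity. x' = x \<longrightarrow> y \<in> U)" for U :: "'a L2 set"
    by (simp add: open_L2_def)
qed

end


section \<open>The momentum operator on the unit square and its extensions\<close>

text \<open>
  \<open>C_k k f\<close>: all iterated partial derivatives of \<open>f\<close> up to order \<open>k\<close> exist and are continuous.
\<close>

primrec C_k :: "nat \<Rightarrow> ('a::euclidean_space \<Rightarrow> complex) \<Rightarrow> bool" where
  "C_k 0 f \<longleftrightarrow> continuous_on UNIV f"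
| "C_k (Suc k) f \<longleftrightarrow> (\<forall>x. f differentiable (at x)) \<and>
     (\<forall>b\<in>Basis. C_k k (\<lambda>x. frechet_derivative f (at x) b))"

definition test_function :: "(real \<times> real \<Rightarrow> complex) \<Rightarrow> bool" where
  "test_function \<phi> \<longleftrightarrow> (\<forall>k. C_k k \<phi>) \<and>
     (\<exists>K. compact K \<and> K \<subseteq> {0<..<1} \<times> {0<..<1} \<and> (\<forall>z. z \<notin> K \<longrightarrow> \<phi> z = 0))"

text \<open>
  \<open>g\<close> is the distributional derivative of \<open>f\<close> with respect to the first variable on the open unit
  square; \<^const>\<open>rep_L2\<close> picks a representative, on which the integrals do not depend. The test
  functions form the domain of the minimal operator \<open>P_min\<close>, so that \<open>P_max\<close> is its adjoint.
\<close>

definition has_weak_dx :: "(real \<times> real) L2 \<Rightarrow> (real \<times> real) L2 \<Rightarrow> bool" where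
  "has_weak_dx f g \<longleftrightarrow> (\<forall>\<phi>. test_function \<phi> \<longrightarrow>
     integral\<^sup>L unit_cube_measure (\<lambda>z. rep_L2 f z * frechet_derivative \<phi> (at z) (1, 0)) =
     - integral\<^sup>L unit_cube_measure (\<lambda>z. rep_L2 g z * \<phi> z))"

definition P_max :: "(real \<times> real) L2 operator" where
  "P_max = ({f. \<exists>g. has_weak_dx f g},
            \<lambda>f. (1 / (\<i> * 2 * complex_of_real pi)) *\<^sub>C (THE g. has_weak_dx f g))"

text \<open>
  The boundary value \<open>f(c, \<cdot>)\<close> is read off from a representative of \<open>f\<close> that is continuous in the
  first variable for almost every value of the second one. Any two such representatives agree, for
  almost every \<open>y\<close>, at all \<open>x\<close> in \<open>[0,1]\<close>; for \<open>f\<close> in the domain of \<open>P_max\<close> one exists,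
  namely the one that is absolutely continuous in the first variable.
\<close>

definition has_boundary_value :: "(real \<times> real) L2 \<Rightarrow> real \<Rightarrow> real L2 \<Rightarrow> bool" where
  "has_boundary_value f c a \<longleftrightarrow> (\<exists>F.
     square_integrable F \<and> abs_L2 F = f \<and>
     (AE y in unit_cube_measure. continuous_on {0..1} (\<lambda>x. F (x, y))) \<and>
     square_integrable (\<lambda>y. F (c, y)) \<and> abs_L2 (\<lambda>y. F (c, y)) = a)"

definition boundary_value :: "real \<Rightarrow> (real \<times> real) L2 \<Rightarrow> real L2" where
  "boundary_value c f = (THE a. has_boundary_value f c a)"

definition P_ext :: "(real L2 \<Rightarrow> real L2) \<Rightarrow> (real \<times> real) L2 operator" where
  "P_ext V = ({f \<in> fst P_max. boundary_value 1 f = V (boundary_value 0 f)}, snd P_max)"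

definition e :: "real \<Rightarrow> complex" where
  "e r = exp (\<i> * 2 * complex_of_real pi * complex_of_real r)"

end

theory Submission
  imports Defs
begin

text \<open>
  Writing \<open>\<zeta> = i 2\<pi> z\<close>, the solutions of \<open>(P_max - z) f = g\<close> are exactly the functions
  \<open>f(x, y) = exp(\<zeta> x) (a(y) + i 2\<pi> \<integral>\<^sub>0\<^sup>x exp(- \<zeta> t) g(t, y) dt)\<close> with \<open>a \<in> L\<^sup>2([0,1])\<close>. Such an \<open>f\<close> has boundary
  values \<open>a\<close> and \<open>\<mu> (a + h)\<close>, where \<open>\<mu> = exp \<zeta>\<close> and \<open>h\<close> depends only on \<open>g\<close>, so it lies in the domain of
  \<open>P_V\<close> iff \<open>(V - \<mu>) a = \<mu> h\<close>. Since every \<open>h \<in> L\<^sup>2([0,1])\<close> arises from some \<open>g\<close>, with norm estimates in both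
  directions, \<open>z\<close> is in the resolvent set of \<open>P_V\<close> iff \<open>\<mu>\<close> is in the resolvent set of \<open>V\<close>. For \<open>z\<close> not
  real \<open>\<bar>\<mu>\<bar> \<noteq> 1\<close>, and then \<open>V - \<mu>\<close> is invertible by Banach's fixed point theorem.
\<close>

section \<open>Smooth functions\<close>

text \<open>The delicate word in the overview is "exactly". Elements of the domain come only with a
  distributional derivative, so the fundamental theorem of calculus does not apply to them directly.
  Its replacement is du Bois-Reymond's lemma with a parameter: a square integrable function whose
  weak x-derivative is zero agrees almost everywhere with a function of y alone. The integrating
  factor exp(- \<zeta> x) and the subtraction of a primitive reduce the general solution to this
  case. The lemma needs many compactly supported smooth functions, hence the explicit bumps built
  from exp(- 1 / x). Boundary values live on null sets of the square, so their independence of the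
  representative has to come from continuity on almost every slice. A resolvent point demands a
  bounded inverse besides bijectivity, so the passage from h to g must be quantitative: g(x, y) =
  exp(\<zeta> x) h(y) / (i 2 \<pi>) works, since its source after multiplication by the integrating
  factor is constant in x. Finally |\<mu>| = exp(- 2 \<pi> Im z), so real z correspond to \<mu> on
  the unit circle.\<close>

lemma C_k_const: "C_k k (\<lambda>_. c)"
  by (induction k arbitrary: c) auto

text \<open>The recursion constrains only derivatives once the order is positive, so lowering the
  order needs an induction. At the bottom, differentiability supplies continuity.\<close>

lemma C_k_Suc_imp: "C_k (Suc k) f \<Longrightarrow> C_k k f"
proof (induction k arbitrary: f)
  case 0
  then show ?case
    by (auto intro!: differentiable_imp_continuous_on simp: differentiable_on_def
        intro: differentiable_at_withinI)
next
  case (Suc k)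
  show ?case
    using Suc.prems Suc.IH by (subst C_k.simps(2)) (auto simp del: C_k.simps(1) dest: C_k.simps(2)[THEN iffD1])
qed

lemma C_k_add:
  "C_k k f \<Longrightarrow> C_k k g \<Longrightarrow> C_k k (\<lambda>x. f x + g x)"
proof (induction k arbitrary: f g)
  case 0
  then show ?case by (auto intro!: continuous_on_add continuous_on_mult)
next
  case (Suc k)
  then have d: "f differentiable (at x)" "g differentiable (at x)" for x by auto
  have "frechet_derivative (\<lambda>x. f x + g x) (at x) =
     (\<lambda>b. frechet_derivative f (at x) b + frechet_derivative g (at x) b)" for x
    using d[of x] by (intro frechet_derivative_at[symmetric] has_derivative_add)
       (auto simp: frechet_derivative_works)
  with Suc d show ?case by auto
qed

lemma C_k_mult:
  "C_k k f \<Longrightarrow> C_k k g \<Longrightarrow> C_k k (\<lambda>x. f x * g x)"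
proof (induction k arbitrary: f g)
  case 0
  then show ?case by (auto intro!: continuous_on_add continuous_on_mult)
next
  case (Suc k)
  then have d: "f differentiable (at x)" "g differentiable (at x)" for x by auto
  have *: "frechet_derivative (\<lambda>x. f x * g x) (at x) =
     (\<lambda>b. f x * frechet_derivative g (at x) b + frechet_derivative f (at x) b * g x)" for x
    using d[of x] by (intro frechet_derivative_at[symmetric] has_derivative_mult)
       (auto simp: frechet_derivative_works)
  \<comment> \<open>The product rule leaves one factor undifferentiated, so the induction hypothesis
    is applied to \<open>f\<close> and \<open>g\<close> themselves as well.\<close>
  have "C_k k f" "C_k k g"
    using Suc.prems by (auto intro: C_k_Suc_imp simp del: C_k.simps)
  then show ?case
    using Suc d by (auto simp: * intro!: C_k_add)
qed

lemma C_k_SucI: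
  fixes f :: "real \<Rightarrow> complex"
  assumes "\<And>x. (f has_vector_derivative f' x) (at x)" "C_k k f'"
  shows "C_k (Suc k) f"
proof -
  have "frechet_derivative f (at x) = (\<lambda>b. b *\<^sub>R f' x)" for x
    using assms(1)[of x] unfolding has_vector_derivative_def
    by (intro frechet_derivative_at[symmetric])
  moreover have "f differentiable (at x)" for x
    using assms(1)[of x] by (rule differentiableI_vector)
  ultimately show ?thesis using assms(2) by simp
qed

lemma C_k_SucD:
  fixes f :: "real \<Rightarrow> complex"
  assumes "C_k (Suc k) f"
  shows "\<exists>f'. (\<forall>x. (f has_vector_derivative f' x) (at x)) \<and> C_k k f'"
proof (intro exI conjI allI)
  fix x
  have "f differentiable (at x)" using assms by simp
  then have D: "(f has_derivative frechet_derivative f (at x)) (at x)"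
    by (simp add: frechet_derivative_works)
  then have "frechet_derivative f (at x) = (\<lambda>b. b *\<^sub>R frechet_derivative f (at x) 1)"
    using linear_cmul[OF linear_frechet_derivative[OF \<open>f differentiable (at x)\<close>], of _ 1]
    by (intro ext) (metis mult.right_neutral real_scaleR_def)
  with D show "(f has_vector_derivative frechet_derivative f (at x) 1) (at x)"
    unfolding has_vector_derivative_def by simp
  show "C_k k (\<lambda>x. frechet_derivative f (at x) 1)"
    using assms by simp
qed

text \<open>A partial derivative of the composition is the constant \<open>p b\<close> times
  \<open>u'\<close> composed with the same \<open>p\<close>, so the induction closes once
  \<open>u\<close> is generalised. With \<open>p\<close> a coordinate projection this turns smooth
  functions of one variable into smooth functions on the plane.\<close>

lemma C_k_coordinate:
  fixes p :: "'a::euclidean_space \<Rightarrow> real"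
  assumes p: "bounded_linear p"
  shows "C_k k u \<Longrightarrow> C_k k (\<lambda>z. u (p z))"
proof (induction k arbitrary: u)
  case 0
  then show ?case
    using continuous_on_compose2[of UNIV u UNIV p] linear_continuous_on[OF p] by simp
next
  case (Suc k)
  obtain u' where u': "\<And>x. (u has_vector_derivative u' x) (at x)" "C_k k u'"
    using C_k_SucD[OF Suc.prems] by blast
  have D: "((\<lambda>z. u (p z)) has_derivative (\<lambda>b. p b *\<^sub>R u' (p z))) (at z)" for z
    using has_derivative_compose[OF bounded_linear_imp_has_derivative[OF p]
        u'(1)[of "p z", unfolded has_vector_derivative_def]] by simp
  then have "frechet_derivative (\<lambda>z. u (p z)) (at z) = (\<lambda>b. p b *\<^sub>R u' (p z))" for z
    by (intro frechet_derivative_at[symmetric])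
  moreover have "C_k k (\<lambda>z. p b *\<^sub>R u' (p z))" for b
    unfolding scaleR_conv_of_real by (intro C_k_mult C_k_const Suc.IH u')
  ultimately show ?case
    using D by (auto simp: differentiable_def)
qed

text \<open>The classical smooth function exp(- 1 / x) extended by 0, with a polynomial in 1 / x as
  an extra factor: this makes the family closed under differentiation, so smoothness becomes one
  induction over all \<open>p\<close>.\<close>

definition flat :: "real poly \<Rightarrow> real \<Rightarrow> real" where
  "flat p x = (if x > 0 then poly p (1 / x) * exp (- (1 / x)) else 0)"

lemma flat_tendsto_0: "(flat p \<longlongrightarrow> 0) (at 0)"
proof -
  \<comment> \<open>Substituting t = 1 / x, the claim from the right is that the exponential beats
    every polynomial.\<close>
  have "((\<lambda>t. poly p t * exp (- t)) \<longlongrightarrow> 0) at_top"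
  proof -
    have "((\<lambda>t. \<Sum>i\<le>degree p. coeff p i * (t ^ i / exp t)) \<longlongrightarrow> (\<Sum>i\<le>degree p. coeff p i * 0)) at_top"
      by (intro tendsto_intros tendsto_power_div_exp_0)
    then show ?thesis
      by (simp add: poly_altdef sum_distrib_right exp_minus divide_inverse mult.assoc)
  qed
  then have "((\<lambda>x. poly p (inverse x) * exp (- inverse x)) \<longlongrightarrow> 0) (at_right 0)"
    by (rule filterlim_compose[OF _ filterlim_inverse_at_top_right])
  then have "(flat p \<longlongrightarrow> 0) (at_right 0)"
    by (rule Lim_transform_eventually)
       (auto simp: flat_def eventually_at_right_less divide_inverse eventually_at intro!: exI[of _ 1])
  moreover have "(flat p \<longlongrightarrow> 0) (at_left 0)"
    by (rule tendsto_eventually) (auto simp: flat_def eventually_at intro!: exI[of _ 1])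
  ultimately show ?thesis
    by (simp add: filterlim_at_split)
qed

text \<open>Differentiating p(1 / x) exp(- 1 / x) gives the factor 1 / x^2 times (p - p')(1 / x);
  the polynomial \<open>[:0, 0, 1:]\<close> is t^2 at t = 1 / x.\<close>

lemma flat_has_derivative:
  "(flat p has_real_derivative flat ([:0, 0, 1:] * (p - pderiv p)) x) (at x)"
proof -
  consider "x > 0" | "x < 0" | "x = 0" by linarith
  then show ?thesis
  proof cases
    case 1
    have "((\<lambda>x. poly p (1 / x) * exp (- (1 / x))) has_real_derivative
       flat ([:0, 0, 1:] * (p - pderiv p)) x) (at x)"
      using 1 by (auto intro!: derivative_eq_intros poly_DERIV[THEN DERIV_chain2]
          simp: flat_def power2_eq_square field_simps)
    then show ?thesis
      by (rule has_field_derivative_transform_within_open[where S="{0<..}"])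
         (use 1 in \<open>auto simp: flat_def\<close>)
  next
    case 2
    have "((\<lambda>_. 0) has_real_derivative flat ([:0, 0, 1:] * (p - pderiv p)) x) (at x)"
      using 2 by (auto simp: flat_def)
    then show ?thesis
      by (rule has_field_derivative_transform_within_open[where S="{..<0}"])
         (use 2 in \<open>auto simp: flat_def\<close>)
  next
    case 3
    \<comment> \<open>The difference quotient at 0 is again a member of the family, with p(t)
      replaced by t p(t), and hence tends to 0.\<close>
    have "flat ([:0, 1:] * p) = (\<lambda>h. (flat p (0 + h) - flat p 0) / h)"
      by (auto simp: flat_def fun_eq_iff field_simps)
    with flat_tendsto_0[of "[:0, 1:] * p"] show ?thesis
      unfolding 3 DERIV_def by (simp add: flat_def)
  qed
qed

lemma C_k_flat_affine: "C_k k (\<lambda>x. of_real (flat p (c * x + d)))"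
proof (induction k arbitrary: p)
  case 0
  have "isCont (flat p) x" for x
    using flat_has_derivative by (rule DERIV_isCont)
  then have "continuous_on UNIV (flat p)"
    by (simp add: continuous_at_imp_continuous_on)
  then show ?case
    by (auto intro!: continuous_intros continuous_on_compose2[of UNIV "flat p"])
next
  case (Suc k)
  show ?case
  proof (rule C_k_SucI)
    let ?q = "[:0, 0, 1:] * (p - pderiv p)"
    show "C_k k (\<lambda>x. of_real c * of_real (flat ?q (c * x + d)))"
      by (intro C_k_mult C_k_const Suc.IH)
    have "((\<lambda>x. flat p (c * x + d)) has_real_derivative flat ?q (c * x + d) * c) (at x)" for x
      by (rule DERIV_chain2[OF flat_has_derivative]) (auto intro!: derivative_eq_intros)
    from has_vector_derivative_of_real[OF this, where 'a=complex]
    show "((\<lambda>x. complex_of_real (flat p (c * x + d))) has_vector_derivative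
        of_real c * of_real (flat ?q (c * x + d))) (at x)" for x
      by (simp only: of_real_mult mult.commute[of "of_real c"])
  qed
qed

text \<open>A smooth approximation of the indicator of the open interval from \<open>a\<close> to
  \<open>b\<close>. The shift by 1 makes each factor vanish up to distance 1 / (n + 1) inside its
  endpoint, so even with a = 0 and b = 1 the support stays away from the boundary, while the margin
  shrinks as \<open>n\<close> grows.\<close>

definition bump :: "nat \<Rightarrow> real \<Rightarrow> real \<Rightarrow> real \<Rightarrow> real" where
  "bump n a b x = flat 1 (real (Suc n) * (x - a) - 1) * flat 1 (real (Suc n) * (b - x) - 1)"

lemma C_k_bump: "C_k k (\<lambda>x. of_real (bump n a b x))"
proof -
  have "C_k k (\<lambda>x. of_real (flat 1 (real (Suc n) * x + (- real (Suc n) * a - 1))) *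
      of_real (flat 1 ((- real (Suc n)) * x + (real (Suc n) * b - 1))))"
    by (intro C_k_mult C_k_flat_affine)
  also have "(\<lambda>x. of_real (flat 1 (real (Suc n) * x + (- real (Suc n) * a - 1))) *
      of_real (flat 1 ((- real (Suc n)) * x + (real (Suc n) * b - 1)))) = (\<lambda>x. complex_of_real (bump n a b x))"
    unfolding bump_def by (simp add: algebra_simps)
  finally show ?thesis .
qed

lemma flat_1_bounds: "0 \<le> flat 1 x" "flat 1 x \<le> 1"
  by (auto simp: flat_def)

lemma bump_bounds: "0 \<le> bump n a b x" "bump n a b x \<le> 1"
  unfolding bump_def using flat_1_bounds by (auto intro!: mult_le_one)

lemma bump_eq_0: "x \<notin> {a + 1 / real (Suc n)..b - 1 / real (Suc n)} \<Longrightarrow> bump n a b x = 0"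
  by (auto simp: bump_def flat_def field_simps)

lemma flat_1_tendsto_1:
  assumes "x > 0"
  shows "(\<lambda>n. flat 1 (real (Suc n) * x - 1)) \<longlonglongrightarrow> 1"
proof -
  have lim: "filterlim (\<lambda>n. real (Suc n) * x - 1) at_top sequentially"
    unfolding diff_conv_add_uminus
    by (intro filterlim_tendsto_add_at_top[OF tendsto_const, of _ _ "- 1", unfolded add.commute[of "- 1"]]
        filterlim_at_top_mult_tendsto_pos[OF tendsto_const assms]
        filterlim_compose[OF filterlim_real_sequentially filterlim_Suc])
  have "((\<lambda>x::real. exp (- inverse x)) \<longlongrightarrow> exp (- 0)) at_top"
    by (intro tendsto_intros tendsto_inverse_0_at_top filterlim_ident)
  then have "((\<lambda>x::real. exp (- (1 / x))) \<longlongrightarrow> 1) at_top"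
    by (simp add: divide_inverse)
  then have "(flat 1 \<longlongrightarrow> 1) at_top"
    by (rule Lim_transform_eventually) (use eventually_gt_at_top[of "0::real"] in \<open>eventually_elim, simp add: flat_def\<close>)
  then show ?thesis
    using lim by (rule filterlim_compose)
qed

lemma bump_tendsto: "(\<lambda>n. bump n a b x) \<longlonglongrightarrow> indicator {a<..<b} x"
proof (cases "x \<in> {a<..<b}")
  case True
  then have "(\<lambda>n. bump n a b x) \<longlonglongrightarrow> 1 * 1"
    unfolding bump_def by (intro tendsto_mult flat_1_tendsto_1) auto
  with True show ?thesis by simp
next
  case False
  have "bump n a b x = 0" for n
  proof (intro bump_eq_0)
    have "0 < 1 / real (Suc n)" by simp
    with False show "x \<notin> {a + 1 / real (Suc n)..b - 1 / real (Suc n)}"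
      by (simp only: atLeastAtMost_iff greaterThanLessThan_iff) linarith
  qed
  with False show ?thesis by simp
qed

section \<open>The measure on the unit square\<close>

lemma space_unit_cube_measure [simp]: "space unit_cube_measure = cbox 0 One"
  by (simp add: unit_cube_measure_def space_restrict_space)

lemma sets_unit_cube_measure: "sets unit_cube_measure = sets (restrict_space borel (cbox 0 One))"
  unfolding unit_cube_measure_def by (rule sets_restrict_space_cong) simp

lemma sets_unit_cube_measure_iff:
  "A \<in> sets unit_cube_measure \<longleftrightarrow> A \<subseteq> cbox 0 One \<and> A \<in> sets borel"
  by (simp add: sets_unit_cube_measure sets_restrict_space_iff)

lemma measurable_unit_cube_measure_borel [measurable (raw)]:
  "f \<in> borel_measurable borel \<Longrightarrow> f \<in> borel_measurable unit_cube_measure"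
  unfolding unit_cube_measure_def by (rule measurable_restrict_space1) simp

lemma emeasure_unit_cube_measure:
  "A \<in> sets unit_cube_measure \<Longrightarrow> emeasure unit_cube_measure A = emeasure lborel A"
  using sets_unit_cube_measure_iff[of A] unfolding unit_cube_measure_def
  by (intro emeasure_restrict_space) auto


lemma finite_measure_unit_cube: "finite_measure (unit_cube_measure :: 'a::euclidean_space measure)"
proof (rule finite_measureI)
  have "emeasure (unit_cube_measure :: 'a measure) (cbox 0 One) = emeasure lborel (cbox 0 One :: 'a set)"
    by (rule emeasure_unit_cube_measure) (simp add: sets_unit_cube_measure_iff)
  then show "emeasure (unit_cube_measure :: 'a measure) (space unit_cube_measure) \<noteq> \<infinity>"
    using emeasure_lborel_cbox_finite[of "0::'a" One] by auto
qed

interpretation unit_cube: finite_measure "unit_cube_measure :: 'a::euclidean_space measure"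
  by (rule finite_measure_unit_cube)

interpretation unit_square: pair_sigma_finite
  "unit_cube_measure :: real measure" "unit_cube_measure :: real measure" ..

lemma One_real_prod: "(One :: real \<times> real) = (1, 1)"
  by (rule euclidean_eqI) (auto simp: Basis_prod_def)

text \<open>This is what makes Fubini's theorem available on the square. By sigma-finiteness it
  suffices to compare the sigma-algebras and the values on rectangles, and the latter are those of
  Lebesgue measure.\<close>

lemma unit_cube_measure_prod:
  "(unit_cube_measure :: (real \<times> real) measure) =
    unit_cube_measure \<Otimes>\<^sub>M unit_cube_measure"
proof (rule pair_measure_eqI[symmetric])
  show sets_eq: "sets (unit_cube_measure \<Otimes>\<^sub>M unit_cube_measure) =
      sets (unit_cube_measure :: (real \<times> real) measure)"
  proof
    have "A \<times> B \<in> sets (unit_cube_measure :: (real \<times> real) measure)"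
      if "A \<in> sets unit_cube_measure" "B \<in> sets unit_cube_measure" for A B
      using that by (auto simp: sets_unit_cube_measure_iff unit_cube_prod borel_prod[symmetric] pair_measureI)
    moreover have "cbox 0 One \<times> cbox 0 One \<in> sets (unit_cube_measure :: (real \<times> real) measure)"
      unfolding sets_unit_cube_measure_iff unit_cube_prod unit_cube_real
      by (auto intro!: closed_Times borel_closed)
    ultimately show "sets (unit_cube_measure \<Otimes>\<^sub>M unit_cube_measure) \<subseteq> sets (unit_cube_measure :: (real \<times> real) measure)"
      unfolding sets_pair_measure
      by (intro sets.sigma_sets_subset') (auto simp del: unit_cube_real unit_cube_prod)
    have id: "(\<lambda>x. x) \<in> measurable unit_cube_measure (borel :: 'c::euclidean_space measure)"
      unfolding unit_cube_measure_def by (rule measurable_restrict_space1) simp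
    have "(\<lambda>z. (fst z, snd z)) \<in> measurable (unit_cube_measure \<Otimes>\<^sub>M unit_cube_measure) (borel :: (real \<times> real) measure)"
      by (intro borel_measurable_Pair measurable_compose[OF measurable_fst id] measurable_compose[OF measurable_snd id])
    then have m: "(\<lambda>z. z) \<in> measurable (unit_cube_measure \<Otimes>\<^sub>M unit_cube_measure) (borel :: (real \<times> real) measure)"
      by simp
    show "sets (unit_cube_measure :: (real \<times> real) measure) \<subseteq> sets (unit_cube_measure \<Otimes>\<^sub>M unit_cube_measure)"
    proof
      fix A :: "(real \<times> real) set"
      assume "A \<in> sets unit_cube_measure"
      then have "A \<subseteq> cbox 0 One \<times> cbox 0 One" "A \<in> sets borel"
        by (auto simp: sets_unit_cube_measure_iff unit_cube_prod)
      with measurable_sets[OF m \<open>A \<in> sets borel\<close>]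
      show "A \<in> sets (unit_cube_measure \<Otimes>\<^sub>M unit_cube_measure)"
        by (simp add: space_pair_measure Int_absorb2)
    qed
  qed
  fix A B :: "real set"
  assume A: "A \<in> sets unit_cube_measure" and B: "B \<in> sets unit_cube_measure"
  have "A \<times> B \<in> sets (unit_cube_measure \<Otimes>\<^sub>M unit_cube_measure)"
    using A B by (rule pair_measureI)
  then have "emeasure unit_cube_measure (A \<times> B) = emeasure (lborel \<Otimes>\<^sub>M lborel) (A \<times> B)"
    unfolding sets_eq lborel_prod by (rule emeasure_unit_cube_measure)
  also have "\<dots> = emeasure lborel A * emeasure lborel B"
    using A B by (intro lborel.emeasure_pair_measure_Times) (auto simp: sets_unit_cube_measure_iff)
  finally show "emeasure unit_cube_measure A * emeasure unit_cube_measure B = emeasure unit_cube_measure (A \<times> B)"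
    using A B by (simp add: emeasure_unit_cube_measure)
qed unfold_locales

section \<open>The fundamental lemma of the calculus of variations on the cube\<close>

lemma AE_unit_cube_box: "AE x in unit_cube_measure. x \<in> box 0 (One::'a::euclidean_space)"
proof -
  have "emeasure lborel (cbox 0 One - box 0 One :: 'a set) = 0"
    by (subst emeasure_Diff) (auto simp: emeasure_lborel_box_eq emeasure_lborel_cbox_eq box_subset_cbox)
  then have "(cbox 0 One - box 0 One :: 'a set) \<in> null_sets unit_cube_measure"
    by (auto simp: null_sets_def emeasure_unit_cube_measure sets_unit_cube_measure_iff)
  then show ?thesis
    by (rule AE_I') auto
qed

lemma AE_unit_square:
  "AE z in unit_cube_measure. z \<in> {0<..<1::real} \<times> {0<..<1::real}"
proof -
  have "box 0 One = {0<..<1::real} \<times> {0<..<1::real}"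
    unfolding One_real_prod zero_prod_def by (auto simp: box_def Basis_prod_def)
  then show ?thesis
    using AE_unit_cube_box[where 'a="real \<times> real"] by simp
qed

text \<open>Open boxes are stable under intersection and generate the Borel sets, so Dynkin's
  argument extends the vanishing to all Borel sets. Uniqueness of densities then applies to the real
  and imaginary parts.\<close>

lemma AE_eq_0_if_box_integrals_eq_0:
  fixes v :: "'a::euclidean_space \<Rightarrow> complex"
  assumes v: "integrable unit_cube_measure v"
    and zero: "\<And>a b. (\<integral>x. indicator (box a b) x *\<^sub>R v x \<partial>unit_cube_measure) = 0"
  shows "AE x in unit_cube_measure. v x = 0"
proof -
  let ?M = "unit_cube_measure :: 'a measure"
  have int: "integrable ?M (\<lambda>x. indicator A x *\<^sub>R v x)" if "A \<in> sets borel" for A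
  proof -
    have "(\<lambda>x. indicat_real A x) \<in> borel_measurable ?M"
      using that by (intro measurable_unit_cube_measure_borel) simp
    then show ?thesis
      using v by (intro Bochner_Integration.integrable_bound[OF v]) (auto split: split_indicator)
  qed
  \<comment> \<open>Needed for complements. The closed cube itself is not an open box, but it
    differs from one by a null set.\<close>
  have total: "integral\<^sup>L ?M v = 0"
  proof -
    have "integral\<^sup>L ?M v = (\<integral>x. indicator (box 0 One) x *\<^sub>R v x \<partial>?M)"
      using v AE_unit_cube_box
      by (intro integral_cong_AE borel_measurable_integrable int) (auto elim: eventually_mono)
    then show ?thesis by (simp add: zero)
  qed
  have "(\<integral>x. indicator A x *\<^sub>R v x \<partial>?M) = 0" if A: "A \<in> sets borel" for A
  proof -
    have "Int_stable (range (\<lambda>(a, b). box a b :: 'a set))"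
      by (auto simp: Int_stable_def box_Int_box)
    moreover have "range (\<lambda>(a, b). box a b :: 'a set) \<subseteq> Pow UNIV"
      by auto
    moreover have "A \<in> sigma_sets UNIV (range (\<lambda>(a, b). box a b))"
      using A unfolding borel_eq_box by simp
    ultimately show ?thesis
    proof (induction rule: sigma_sets_induct_disjoint)
      case (basic A)
      then show ?case by (auto simp: zero)
    next
      case empty
      then show ?case by simp
    next
      case (compl A)
      then have [measurable]: "A \<in> sets borel"
        by (simp add: borel_eq_box)
      have "(\<integral>x. indicator (UNIV - A) x *\<^sub>R v x \<partial>?M) = (\<integral>x. v x - indicator A x *\<^sub>R v x \<partial>?M)"
        by (intro Bochner_Integration.integral_cong) (auto split: split_indicator)
      also have "\<dots> = 0"
        using compl by (simp add: v int total)
      finally show ?case .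
    next
      case (union F)
      then have F: "F i \<in> sets borel" for i
        by (simp add: borel_eq_box subset_eq)
      have "(\<lambda>n. \<integral>x. indicator (\<Union>i<n. F i) x *\<^sub>R v x \<partial>?M)
          \<longlonglongrightarrow> (\<integral>x. indicator (\<Union>i. F i) x *\<^sub>R v x \<partial>?M)"
      proof (rule integral_dominated_convergence[where w="\<lambda>x. norm (v x)"])
        show "AE x in ?M. (\<lambda>n. indicator (\<Union>i<n. F i) x *\<^sub>R v x) \<longlonglongrightarrow> indicator (\<Union>i. F i) x *\<^sub>R v x"
          by (intro always_eventually allI tendsto_intros LIMSEQ_indicator_UN)
        show "AE x in ?M. norm (indicator (\<Union>i<n. F i) x *\<^sub>R v x) \<le> norm (v x)" for n
          by (auto split: split_indicator)
      qed (use v F in \<open>auto intro!: borel_measurable_integrable int\<close>)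
      moreover have "(\<integral>x. indicator (\<Union>i<n. F i) x *\<^sub>R v x \<partial>?M) = 0" for n
      proof -
        have "indicator (\<Union>i<n. F i) x *\<^sub>R v x = (\<Sum>i<n. indicator (F i) x *\<^sub>R v x)" for x
          using disjoint_family_on_mono[OF subset_UNIV union(1)]
          by (simp only: indicator_UN_disjoint[OF finite_lessThan] scaleR_sum_left)
        then have "(\<integral>x. indicator (\<Union>i<n. F i) x *\<^sub>R v x \<partial>?M) =
            (\<Sum>i<n. \<integral>x. indicator (F i) x *\<^sub>R v x \<partial>?M)"
          by (simp only: Bochner_Integration.integral_sum[OF int[OF F]])
        then show ?thesis
          using union by simp
      qed
      ultimately show ?case
        by (simp add: LIMSEQ_const_iff)
    qed
  qed
  note zero_borel = this
  have zero_sets: "(\<integral>x\<in>A. v x \<partial>?M) = 0" if "A \<in> sets ?M" for A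
    using that zero_borel[of A] by (simp add: set_lebesgue_integral_def sets_unit_cube_measure_iff)
  have si: "set_integrable ?M A v" if "A \<in> sets ?M" for A
    using that v by (rule integrable_mult_indicator[folded set_integrable_def])
  have "AE x in ?M. Re (v x) = 0"
  proof (rule density_unique_real)
    show "(\<integral>x\<in>A. Re (v x) \<partial>?M) = (\<integral>x\<in>A. 0 \<partial>?M)" if "A \<in> sets ?M" for A
      using zero_sets[OF that] integral_Re[OF si[OF that, unfolded set_integrable_def]]
      by (simp add: set_lebesgue_integral_def)
  qed (use v in auto)
  moreover have "AE x in ?M. Im (v x) = 0"
  proof (rule density_unique_real)
    show "(\<integral>x\<in>A. Im (v x) \<partial>?M) = (\<integral>x\<in>A. 0 \<partial>?M)" if "A \<in> sets ?M" for A
      using zero_sets[OF that] integral_Im[OF si[OF that, unfolded set_integrable_def]]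
      by (simp add: set_lebesgue_integral_def)
  qed (use v in auto)
  ultimately show ?thesis
    by eventually_elim (simp add: complex_eq_iff)
qed

lemma borel_measurable_bump [measurable]: "bump n a b \<in> borel_measurable borel"
proof -
  have "continuous_on UNIV (\<lambda>x. complex_of_real (bump n a b x))"
    using C_k_bump[of 0] by simp
  then have "continuous_on UNIV (\<lambda>x. Re (complex_of_real (bump n a b x)))"
    by (rule continuous_on_Re)
  then show ?thesis by (intro borel_measurable_continuous_onI) simp
qed

text \<open>Products of bumps converge pointwise to indicators of open boxes and are bounded by 1,
  so dominated convergence with majorant |v| reduces this to integrals over boxes.\<close>

lemma AE_eq_0_if_bump_integrals_eq_0:
  fixes v :: "real \<times> real \<Rightarrow> complex"
  assumes v: "integrable unit_cube_measure v"
    and zero: "\<And>n a b c d. 0 \<le> a \<Longrightarrow> b \<le> 1 \<Longrightarrow> 0 \<le> c \<Longrightarrow> d \<le> 1 \<Longrightarrow>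
      (\<integral>z. v z * of_real (bump n a b (fst z) * bump n c d (snd z)) \<partial>unit_cube_measure) = 0"
  shows "AE z in unit_cube_measure. v z = 0"
proof (rule AE_eq_0_if_box_integrals_eq_0[OF v])
  let ?M = "unit_cube_measure :: (real \<times> real) measure"
  fix p q :: "real \<times> real"
  \<comment> \<open>The box is clipped to the unit square to meet the range restrictions of the
    hypothesis; on the open square, hence almost everywhere, its indicator does not change.\<close>
  define a b c d where "a = max 0 (fst p)" "b = min 1 (fst q)" "c = max 0 (snd p)" "d = min 1 (snd q)"
  have [measurable]: "v \<in> borel_measurable ?M" using v by auto
  have "(\<lambda>z. indicat_real {a<..<b} (fst z) * indicator {c<..<d} (snd z)) \<in> borel_measurable (borel :: (real \<times> real) measure)"
    unfolding borel_prod[symmetric] by measurable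
  then have [measurable]: "(\<lambda>z. indicat_real {a<..<b} (fst z) * indicator {c<..<d} (snd z)) \<in> borel_measurable ?M"
    by (rule measurable_unit_cube_measure_borel)
  have lim_meas: "(\<lambda>z. v z * of_real (indicator {a<..<b} (fst z) * indicator {c<..<d} (snd z))) \<in> borel_measurable ?M"
    by measurable
  have "(\<lambda>n. \<integral>z. v z * of_real (bump n a b (fst z) * bump n c d (snd z)) \<partial>?M)
      \<longlonglongrightarrow> (\<integral>z. v z * of_real (indicator {a<..<b} (fst z) * indicator {c<..<d} (snd z)) \<partial>?M)"
  proof (rule integral_dominated_convergence[where w="\<lambda>z. norm (v z)"])
    show "AE z in ?M. (\<lambda>n. v z * of_real (bump n a b (fst z) * bump n c d (snd z)))
        \<longlonglongrightarrow> v z * of_real (indicator {a<..<b} (fst z) * indicator {c<..<d} (snd z))"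
      by (intro always_eventually allI tendsto_intros bump_tendsto)
    show "AE z in ?M. norm (v z * of_real (bump n a b (fst z) * bump n c d (snd z))) \<le> norm (v z)" for n
      using bump_bounds by (auto simp: norm_mult abs_mult intro!: mult_left_le mult_le_one)
    have "(\<lambda>z. bump n a b (fst z) * bump n c d (snd z)) \<in> borel_measurable (borel :: (real \<times> real) measure)" for n
      unfolding borel_prod[symmetric] by measurable
    then have [measurable]: "(\<lambda>z. bump n a b (fst z) * bump n c d (snd z)) \<in> borel_measurable ?M" for n
      by (rule measurable_unit_cube_measure_borel)
    show "(\<lambda>z. v z * of_real (bump n a b (fst z) * bump n c d (snd z))) \<in> borel_measurable ?M" for n
      by measurable
    show "(\<lambda>z. v z * of_real (indicator {a<..<b} (fst z) * indicator {c<..<d} (snd z))) \<in> borel_measurable ?M"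
      by (rule lim_meas)
    show "integrable ?M (\<lambda>z. norm (v z))" using v by auto
  qed
  then have "(\<integral>z. v z * of_real (indicator {a<..<b} (fst z) * indicator {c<..<d} (snd z)) \<partial>?M) = 0"
    by (subst (asm) zero) (auto simp: a_b_c_d_def LIMSEQ_const_iff)
  moreover have "(\<integral>z. indicator (box p q) z *\<^sub>R v z \<partial>?M) =
      (\<integral>z. v z * of_real (indicator {a<..<b} (fst z) * indicator {c<..<d} (snd z)) \<partial>?M)"
  proof (rule integral_cong_AE)
    show "AE z in ?M. indicator (box p q) z *\<^sub>R v z =
        v z * of_real (indicator {a<..<b} (fst z) * indicator {c<..<d} (snd z))"
      using AE_unit_square
      by eventually_elim
        (cases p; cases q; auto simp: box_def Basis_prod_def a_b_c_d_def scaleR_conv_of_real split: split_indicator)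
  qed (use v lim_meas in auto)
  ultimately show "(\<integral>z. indicator (box p q) z *\<^sub>R v z \<partial>?M) = 0" by simp
qed

section \<open>Slices and primitives\<close>

abbreviation unit_interval_measure :: "real measure" ("U\<^sub>1") where
  "U\<^sub>1 \<equiv> unit_cube_measure"

abbreviation unit_square_measure :: "(real \<times> real) measure" ("U\<^sub>2") where
  "U\<^sub>2 \<equiv> unit_cube_measure"

lemma measure_unit_cube: "measure (unit_cube_measure :: 'a::euclidean_space measure) (cbox 0 One) = 1"
proof -
  have "emeasure (unit_cube_measure :: 'a measure) (cbox 0 One) = emeasure lborel (cbox 0 One :: 'a set)"
    by (rule emeasure_unit_cube_measure) (simp add: sets_unit_cube_measure_iff)
  then have "emeasure (unit_cube_measure :: 'a measure) (cbox 0 One) = 1"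
    by (simp add: emeasure_lborel_cbox_eq)
  then show ?thesis by (simp add: measure_def)
qed

lemma measure_unit_interval_square [simp]:
  "measure U\<^sub>1 {0..1} = 1" "measure U\<^sub>2 ({0..1} \<times> {0..1}) = 1"
  using measure_unit_cube[where 'a=real] measure_unit_cube[where 'a="real \<times> real"]
  by (simp_all add: unit_cube_prod)

lemma integral_const_unit_cube [simp]:
  fixes c :: "'b::{banach, second_countable_topology}"
  shows "(\<integral>x. c \<partial>(unit_cube_measure :: 'a::euclidean_space measure)) = c"
  by (simp add: measure_unit_cube del: unit_cube_real)

lemma integral_unit_interval_eq:
  fixes f :: "real \<Rightarrow> complex"
  assumes "continuous_on {0..1} f"
  shows "integrable U\<^sub>1 f" "integral\<^sup>L U\<^sub>1 f = integral {0..1} f"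
proof -
  have si: "set_integrable lborel {0..1} f"
    by (rule borel_integrable_atLeastAtMost'[OF assms])
  then show "integrable U\<^sub>1 f"
    unfolding unit_cube_measure_def set_integrable_def by (subst integrable_restrict_space) auto
  show "integral\<^sup>L U\<^sub>1 f = integral {0..1} f"
    using set_borel_integral_eq_integral(2)[OF si]
    unfolding unit_cube_measure_def set_lebesgue_integral_def by (subst integral_restrict_space) auto
qed

text \<open>Passes from almost everywhere to a prescribed point, which is itself a null set: the
  continuous function |f| has integral zero on the interval.\<close>

lemma continuous_AE_eq_0:
  fixes f :: "real \<Rightarrow> complex"
  assumes f: "continuous_on {0..1} f" and ae: "AE x in U\<^sub>1. f x = 0" and x: "x \<in> {0..1}"
  shows "f x = 0"
proof -
  have c: "continuous_on {0..1} (\<lambda>x. complex_of_real (cmod (f x)))"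
    using f by (intro continuous_intros)
  have "integral {0..1} (\<lambda>x. complex_of_real (cmod (f x))) = 0"
    unfolding integral_unit_interval_eq(2)[OF c, symmetric]
    using ae by (intro integral_eq_zero_AE) auto
  then have "integral {0..1} (\<lambda>x. cmod (f x)) = 0"
    using integral_linear[OF _ bounded_linear_Re, of "\<lambda>x. complex_of_real (cmod (f x))" "{0..1}"] integrable_continuous_real[OF c]
    by (simp add: o_def)
  then have "\<forall>x\<in>{0..1}. cmod (f x) = 0"
    using f by (subst (asm) integral_eq_0_iff) (auto intro: continuous_intros)
  with x show ?thesis by simp
qed

lemma integrable_mult_continuous:
  fixes f :: "'a::euclidean_space \<Rightarrow> complex"
  assumes f: "integrable unit_cube_measure f" and k: "continuous_on UNIV k"
  shows "integrable unit_cube_measure (\<lambda>x. f x * k x)"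
proof -
  have "compact (k ` cbox 0 (One::'a))"
    using k by (intro compact_continuous_image) (auto intro: continuous_on_subset)
  then have "bounded (k ` cbox 0 (One::'a))"
    by (rule compact_imp_bounded)
  then obtain B where "\<forall>w\<in>k ` cbox 0 (One::'a). norm w \<le> B"
    unfolding bounded_iff ..
  then have B: "norm (k x) \<le> B" if "x \<in> cbox 0 One" for x
    using that by blast
  have [measurable]: "k \<in> borel_measurable unit_cube_measure"
    using k by (intro measurable_unit_cube_measure_borel borel_measurable_continuous_onI)
  have [measurable]: "f \<in> borel_measurable unit_cube_measure"
    using f by auto
  show ?thesis
  proof (rule Bochner_Integration.integrable_bound)
    show "integrable unit_cube_measure (\<lambda>x. of_real B * f x)" using f by auto
    show "AE x in unit_cube_measure. norm (f x * k x) \<le> norm (of_real B * f x)"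
      using order.trans[OF B abs_ge_self]
      by (intro AE_I2) (auto simp: norm_mult mult.commute[of "abs B"] simp del: unit_cube_real unit_cube_prod intro!: mult_left_mono)
  qed measurable
qed

lemma square_integrable_const: "square_integrable (\<lambda>_. c)"
  by (simp add: square_integrable_def)

lemma square_integrable_imp_integrable:
  "square_integrable f \<Longrightarrow> integrable unit_cube_measure f"
  using integrable_cnj_mult[OF square_integrable_const[of 1]] by simp

lemma square_integrable_mult_continuous:
  assumes f: "square_integrable f" and k: "continuous_on UNIV k"
  shows "square_integrable (\<lambda>x. f x * k x)"
proof -
  have "k \<in> borel_measurable unit_cube_measure"
    using k by (intro measurable_unit_cube_measure_borel borel_measurable_continuous_onI)
  moreover have "integrable unit_cube_measure (\<lambda>x. complex_of_real ((cmod (f x))\<^sup>2) * complex_of_real ((cmod (k x))\<^sup>2))"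
    using f k by (intro integrable_mult_continuous continuous_intros)
      (auto simp: square_integrable_def simp del: of_real_power)
  then have "integrable unit_cube_measure (\<lambda>x. Re (complex_of_real ((cmod (f x))\<^sup>2) * complex_of_real ((cmod (k x))\<^sup>2)))"
    by (rule integrable_Re)
  then have "integrable unit_cube_measure (\<lambda>x. (cmod (f x * k x))\<^sup>2)"
    by (simp only: of_real_mult[symmetric] Re_complex_of_real norm_mult power_mult_distrib)
  ultimately show ?thesis
    using f unfolding square_integrable_def by (intro conjI borel_measurable_times) auto
qed

lemma square_integrable_AE_bound:
  assumes "f \<in> borel_measurable unit_cube_measure" "integrable unit_cube_measure g"
    and "AE x in unit_cube_measure. (cmod (f x))\<^sup>2 \<le> g x"
  shows "square_integrable f"
  unfolding square_integrable_def
proof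
  show "integrable unit_cube_measure (\<lambda>x. (cmod (f x))\<^sup>2)"
    by (rule Bochner_Integration.integrable_bound[OF assms(2)])
      (use assms in \<open>auto elim!: eventually_mono\<close>)
qed (use assms in auto)

text \<open>Cauchy-Schwarz on a space of total mass 1, in the form that the variance of |f| is
  nonnegative.\<close>

lemma norm_integral_power2_le:
  fixes f :: "'a::euclidean_space \<Rightarrow> complex"
  assumes "square_integrable f"
  shows "(cmod (integral\<^sup>L unit_cube_measure f))\<^sup>2 \<le> (\<integral>x. (cmod (f x))\<^sup>2 \<partial>unit_cube_measure)"
proof -
  let ?M = "unit_cube_measure :: 'a measure"
  define m where "m = (\<integral>x. cmod (f x) \<partial>?M)"
  have i: "integrable ?M (\<lambda>x. cmod (f x))" "integrable ?M (\<lambda>x. (cmod (f x))\<^sup>2)"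
    using square_integrable_imp_integrable[OF assms] assms by (auto simp: square_integrable_def)
  have "0 \<le> (\<integral>x. (cmod (f x) - m)\<^sup>2 \<partial>?M)" by simp
  also have "\<dots> = (\<integral>x. (cmod (f x))\<^sup>2 - 2 * m * cmod (f x) + m\<^sup>2 \<partial>?M)"
    by (simp add: power2_diff algebra_simps)
  also have "\<dots> = (\<integral>x. (cmod (f x))\<^sup>2 \<partial>?M) - 2 * m * m + m\<^sup>2"
    using i by (simp add: m_def measure_unit_cube)
  finally have "m\<^sup>2 \<le> (\<integral>x. (cmod (f x))\<^sup>2 \<partial>?M)"
    by (simp add: power2_eq_square)
  moreover have "cmod (integral\<^sup>L ?M f) \<le> m"
    unfolding m_def by (rule integral_norm_bound)
  ultimately show ?thesis
    by (meson norm_ge_zero order.trans power_mono)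
qed

lemma
  fixes f :: "real \<times> real \<Rightarrow> 'b::{banach, second_countable_topology}"
  assumes f: "integrable U\<^sub>2 f"
  shows AE_integrable_slice: "AE y in U\<^sub>1. integrable U\<^sub>1 (\<lambda>x. f (x, y))"
    and integrable_slice_integral: "integrable U\<^sub>1 (\<lambda>y. \<integral>x. f (x, y) \<partial>U\<^sub>1)"
    and integral_unit_square: "integral\<^sup>L U\<^sub>2 f = (\<integral>y. (\<integral>x. f (x, y) \<partial>U\<^sub>1) \<partial>U\<^sub>1)"
proof -
  have *: "integrable (U\<^sub>1 \<Otimes>\<^sub>M U\<^sub>1) (case_prod (\<lambda>x y. f (x, y)))"
    using f by (simp add: unit_cube_measure_prod)
  show "AE y in U\<^sub>1. integrable U\<^sub>1 (\<lambda>x. f (x, y))"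
    using unit_square.AE_integrable_snd[OF *] .
  show "integrable U\<^sub>1 (\<lambda>y. \<integral>x. f (x, y) \<partial>U\<^sub>1)"
    using unit_square.integrable_snd[OF *] .
  show "integral\<^sup>L U\<^sub>2 f = (\<integral>y. (\<integral>x. f (x, y) \<partial>U\<^sub>1) \<partial>U\<^sub>1)"
    using unit_square.integral_snd[OF *] by (simp add: unit_cube_measure_prod)
qed

lemma measurable_snd_unit_square:
  "f \<in> borel_measurable U\<^sub>1 \<Longrightarrow> (\<lambda>z. f (snd z)) \<in> borel_measurable U\<^sub>2"
  unfolding unit_cube_measure_prod by (rule measurable_compose[OF measurable_snd])

lemma measurable_slice_unit_square:
  "f \<in> borel_measurable U\<^sub>2 \<Longrightarrow> y \<in> {0..1} \<Longrightarrow> (\<lambda>x. f (x, y)) \<in> borel_measurable U\<^sub>1"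
  unfolding unit_cube_measure_prod
  by (rule measurable_compose[of "\<lambda>x. (x, y)" _ "U\<^sub>1 \<Otimes>\<^sub>M U\<^sub>1"]) auto

lemma integrable_snd_unit_square:
  fixes h :: "real \<Rightarrow> 'b::{banach, second_countable_topology}"
  assumes h: "integrable U\<^sub>1 h"
  shows "integrable U\<^sub>2 (\<lambda>z. h (snd z))" "(\<integral>z. h (snd z) \<partial>U\<^sub>2) = integral\<^sup>L U\<^sub>1 h"
proof -
  have "integrable (U\<^sub>1 \<Otimes>\<^sub>M U\<^sub>1) (\<lambda>z. h (snd z))"
  proof (rule unit_square.Fubini_integrable)
    show "(\<lambda>z. h (snd z)) \<in> borel_measurable (U\<^sub>1 \<Otimes>\<^sub>M U\<^sub>1)"
      by (rule measurable_compose[OF measurable_snd borel_measurable_integrable[OF h]])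
    show "integrable U\<^sub>1 (\<lambda>x. \<integral>y. norm (h (snd (x, y))) \<partial>U\<^sub>1)"
      unfolding snd_conv by (rule unit_cube.integrable_const)
    show "AE x in U\<^sub>1. integrable U\<^sub>1 (\<lambda>y. h (snd (x, y)))"
      unfolding snd_conv by (intro AE_I2 h)
  qed
  then show i: "integrable U\<^sub>2 (\<lambda>z. h (snd z))"
    by (simp only: unit_cube_measure_prod)
  show "(\<integral>z. h (snd z) \<partial>U\<^sub>2) = integral\<^sup>L U\<^sub>1 h"
    unfolding integral_unit_square[OF i] snd_conv integral_const_unit_cube ..
qed

lemma AE_snd_unit_square:
  assumes "AE y in U\<^sub>1. P y"
  shows "AE z in U\<^sub>2. P (snd z)"
proof -
  obtain N where N: "N \<in> null_sets U\<^sub>1" "{y \<in> space U\<^sub>1. \<not> P y} \<subseteq> N"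
    using assms by (auto simp: eventually_ae_filter)
  have "emeasure (U\<^sub>1 \<Otimes>\<^sub>M U\<^sub>1) (space U\<^sub>1 \<times> N) = emeasure U\<^sub>1 (space U\<^sub>1) * emeasure U\<^sub>1 N"
    using N by (intro unit_cube.emeasure_pair_measure_Times sets.top) auto
  then have "space U\<^sub>1 \<times> N \<in> null_sets U\<^sub>2"
    using N sets.top[of U\<^sub>1] unfolding unit_cube_measure_prod
    by (auto simp: null_sets_def simp del: space_unit_cube_measure intro!: pair_measureI)
  then show ?thesis
    by (rule AE_I') (use N in \<open>auto simp: unit_cube_measure_prod space_pair_measure\<close>)
qed

lemma square_integrable_snd:
  assumes "square_integrable a"
  shows "square_integrable (\<lambda>z::real \<times> real. a (snd z))"
  using assms measurable_snd_unit_square[of a] integrable_snd_unit_square(1)[of "\<lambda>y. (cmod (a y))\<^sup>2"]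
  by (simp add: square_integrable_def)

text \<open>Serves as the integrable majorant, depending on y alone, for the squared modulus of
  primitives in x.\<close>

definition slice_energy :: "(real \<times> real \<Rightarrow> complex) \<Rightarrow> real \<Rightarrow> real" where
  "slice_energy g y = (\<integral>x. (cmod (g (x, y)))\<^sup>2 \<partial>U\<^sub>1)"

lemma integrable_slice_energy:
  assumes "square_integrable g"
  shows "integrable U\<^sub>1 (slice_energy g)"
    "integral\<^sup>L U\<^sub>1 (slice_energy g) = (\<integral>z. (cmod (g z))\<^sup>2 \<partial>U\<^sub>2)"
proof -
  have i: "integrable U\<^sub>2 (\<lambda>z. (cmod (g z))\<^sup>2)"
    using assms by (simp add: square_integrable_def)
  show "integrable U\<^sub>1 (slice_energy g)"
    using integrable_slice_integral[OF i] by (simp add: slice_energy_def[abs_def])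
  show "integral\<^sup>L U\<^sub>1 (slice_energy g) = (\<integral>z. (cmod (g z))\<^sup>2 \<partial>U\<^sub>2)"
    using integral_unit_square[OF i] by (simp add: slice_energy_def[abs_def])
qed

lemma AE_square_integrable_slice:
  fixes g :: "real \<times> real \<Rightarrow> complex"
  assumes g: "square_integrable g"
  shows "AE y in U\<^sub>1. square_integrable (\<lambda>x. g (x, y))"
proof -
  have i: "integrable U\<^sub>2 (\<lambda>z. (cmod (g z))\<^sup>2)" and m: "g \<in> borel_measurable U\<^sub>2"
    using g unfolding square_integrable_def by blast+
  show ?thesis
    using AE_integrable_slice[OF i] AE_space
  proof eventually_elim
    case (elim y)
    then have "y \<in> {0..1}" by simp
    from measurable_slice_unit_square[OF m this] elim(1) show ?case
      unfolding square_integrable_def ..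
  qed
qed

text \<open>The primitive in x that vanishes at x = 0. Keeping the domain of integration fixed and
  moving the upper limit into an indicator turns joint measurability into that of a parameter
  integral, and integration by parts into Fubini.\<close>

definition prim :: "(real \<times> real \<Rightarrow> complex) \<Rightarrow> real \<times> real \<Rightarrow> complex" where
  "prim g z = (\<integral>t. indicator {..fst z} t * g (t, snd z) \<partial>U\<^sub>1)"

text \<open>Cauchy-Schwarz on the unit interval. The bound does not involve x, so it controls the
  primitive on the whole square and its value at x = 1 alike.\<close>

lemma norm_prim_power2_le:
  fixes g :: "real \<times> real \<Rightarrow> complex"
  assumes "square_integrable (\<lambda>x. g (x, y))"
  shows "(cmod (prim g (x, y)))\<^sup>2 \<le> slice_energy g y"
proof -
  have [measurable]: "(\<lambda>x. g (x, y)) \<in> borel_measurable U\<^sub>1"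
    and i: "integrable U\<^sub>1 (\<lambda>t. (cmod (g (t, y)))\<^sup>2)"
    using assms by (auto simp: square_integrable_def)
  have [measurable]: "indicator {..x} \<in> borel_measurable U\<^sub>1"
    by (rule measurable_unit_cube_measure_borel) simp
  have si: "square_integrable (\<lambda>t. indicator {..x} t * g (t, y))"
    by (rule square_integrable_AE_bound[OF _ i]) (auto split: split_indicator)
  have "(cmod (prim g (x, y)))\<^sup>2 \<le> (\<integral>t. (cmod (indicator {..x} t * g (t, y)))\<^sup>2 \<partial>U\<^sub>1)"
    unfolding prim_def using norm_integral_power2_le[OF si] by simp
  also have "\<dots> \<le> slice_energy g y"
    unfolding slice_energy_def using si i
    by (intro integral_mono) (auto simp: square_integrable_def split: split_indicator)
  finally show ?thesis .
qed

lemma AE_norm_prim_power2_le: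
  assumes "square_integrable g"
  shows "AE y in U\<^sub>1. \<forall>x. (cmod (prim g (x, y)))\<^sup>2 \<le> slice_energy g y"
  using AE_square_integrable_slice[OF assms] by eventually_elim (blast intro: norm_prim_power2_le)

lemma borel_measurable_prim:
  assumes "g \<in> borel_measurable U\<^sub>2"
  shows "prim g \<in> borel_measurable U\<^sub>2"
proof -
  have [measurable]: "g \<in> borel_measurable (U\<^sub>1 \<Otimes>\<^sub>M U\<^sub>1)"
    using assms by (simp add: unit_cube_measure_prod)
  have [measurable]: "(\<lambda>x. x) \<in> measurable U\<^sub>1 borel"
    by (rule measurable_unit_cube_measure_borel) simp
  have "(\<lambda>p. g (snd p, snd (fst p))) \<in> borel_measurable ((U\<^sub>1 \<Otimes>\<^sub>M U\<^sub>1) \<Otimes>\<^sub>M U\<^sub>1)"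
    by measurable
  moreover have "(\<lambda>p. of_bool (snd p \<le> fst (fst p)) :: complex) \<in> borel_measurable ((U\<^sub>1 \<Otimes>\<^sub>M U\<^sub>1) \<Otimes>\<^sub>M U\<^sub>1)"
  proof -
    have "(\<lambda>p. snd p) \<in> borel_measurable ((U\<^sub>1 \<Otimes>\<^sub>M U\<^sub>1) \<Otimes>\<^sub>M U\<^sub>1)"
      by (rule measurable_compose[OF measurable_snd]) measurable
    moreover have "(\<lambda>p. fst (fst p)) \<in> borel_measurable ((U\<^sub>1 \<Otimes>\<^sub>M U\<^sub>1) \<Otimes>\<^sub>M U\<^sub>1)"
      by (rule measurable_compose[OF measurable_fst], rule measurable_compose[OF measurable_fst]) measurable
    ultimately have "Measurable.pred ((U\<^sub>1 \<Otimes>\<^sub>M U\<^sub>1) \<Otimes>\<^sub>M U\<^sub>1) (\<lambda>p. snd p \<le> fst (fst p))"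
      by measurable
    then show ?thesis unfolding of_bool_def by (intro measurable_If) auto
  qed
  ultimately have "(\<lambda>p. of_bool (snd p \<le> fst (fst p)) * g (snd p, snd (fst p)))
      \<in> borel_measurable ((U\<^sub>1 \<Otimes>\<^sub>M U\<^sub>1) \<Otimes>\<^sub>M U\<^sub>1)"
    by (intro borel_measurable_times)
  then have "(\<lambda>(z, t). of_bool (t \<le> fst z) * g (t, snd z)) \<in> borel_measurable ((U\<^sub>1 \<Otimes>\<^sub>M U\<^sub>1) \<Otimes>\<^sub>M U\<^sub>1)"
    by (simp add: case_prod_beta)
  from unit_cube.borel_measurable_lebesgue_integral[OF this]
  show ?thesis
    by (simp add: prim_def[abs_def] unit_cube_measure_prod indicator_def)
qed

lemma borel_measurable_prim_slice:
  assumes "g \<in> borel_measurable U\<^sub>2" "x \<in> {0..1}"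
  shows "(\<lambda>y. prim g (x, y)) \<in> borel_measurable U\<^sub>1"
proof (rule measurable_compose[OF _ borel_measurable_prim[OF assms(1)]])
  show "(\<lambda>y. (x, y)) \<in> measurable U\<^sub>1 U\<^sub>2"
    unfolding unit_cube_measure_prod using assms(2) by (intro measurable_Pair1') simp
qed

lemma square_integrable_prim:
  assumes "square_integrable g"
  shows "square_integrable (prim g)"
proof (rule square_integrable_AE_bound)
  show "prim g \<in> borel_measurable U\<^sub>2"
    using assms by (intro borel_measurable_prim) (simp add: square_integrable_def)
  show "integrable U\<^sub>2 (\<lambda>z. slice_energy g (snd z))"
    by (intro integrable_snd_unit_square integrable_slice_energy assms)
  show "AE z in U\<^sub>2. (cmod (prim g z))\<^sup>2 \<le> slice_energy g (snd z)"
    using AE_snd_unit_square[OF AE_norm_prim_power2_le[OF assms]]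
    by eventually_elim (metis prod.collapse)
qed

lemma square_integrable_prim_slice:
  assumes "square_integrable g" "x \<in> {0..1}"
  shows "square_integrable (\<lambda>y. prim g (x, y))"
proof (rule square_integrable_AE_bound)
  show "(\<lambda>y. prim g (x, y)) \<in> borel_measurable U\<^sub>1"
    using assms by (intro borel_measurable_prim_slice) (simp_all add: square_integrable_def)
  show "integrable U\<^sub>1 (slice_energy g)"
    by (intro integrable_slice_energy assms)
  show "AE y in U\<^sub>1. (cmod (prim g (x, y)))\<^sup>2 \<le> slice_energy g y"
    using AE_norm_prim_power2_le[OF assms(1)] by eventually_elim blast
qed

lemma AE_unit_interval_neq: "AE t in U\<^sub>1. t \<noteq> x"
proof -
  have "{x} \<inter> {0..1} \<in> null_sets U\<^sub>1"
  proof -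
    have "{x} \<inter> {0..1} \<in> sets U\<^sub>1" by (auto simp: sets_unit_cube_measure_iff)
    moreover have "emeasure lborel ({x} \<inter> {0..1}) \<le> emeasure lborel {x}" by (rule emeasure_mono) auto
    ultimately show ?thesis by (auto simp: null_sets_def emeasure_unit_cube_measure)
  qed
  then show ?thesis by (rule AE_I') auto
qed

lemma prim_0: "prim g (0, y) = 0"
  unfolding prim_def
proof (rule integral_eq_zero_AE)
  \<comment> \<open>Inside the unit interval the set \<open>{..0}\<close> contains only the point 0,
    which is null.\<close>
  show "AE t in U\<^sub>1. indicator {..fst (0, y)} t * g (t, snd (0, y)) = 0"
    using AE_unit_interval_neq[of 0] AE_space by eventually_elim auto
qed

lemma continuous_on_prim:
  fixes g :: "real \<times> real \<Rightarrow> complex"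
  assumes i: "integrable U\<^sub>1 (\<lambda>t. g (t, y))"
  shows "continuous_on {0..1} (\<lambda>x. prim g (x, y))"
  unfolding continuous_on_sequentially
proof (intro allI ballI impI, elim conjE)
  fix s :: "nat \<Rightarrow> real" and x assume s: "s \<longlonglongrightarrow> x"
  have [measurable]: "indicator {..c} \<in> borel_measurable U\<^sub>1" for c :: real
    by (rule measurable_unit_cube_measure_borel) simp
  have [measurable]: "(\<lambda>t. g (t, y)) \<in> borel_measurable U\<^sub>1" using i by auto
  have "(\<lambda>n. \<integral>t. indicator {..s n} t * g (t, y) \<partial>U\<^sub>1) \<longlonglongrightarrow> (\<integral>t. indicator {..x} t * g (t, y) \<partial>U\<^sub>1)"
  proof (rule integral_dominated_convergence[where w="\<lambda>t. norm (g (t, y))"])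
    \<comment> \<open>For t different from the limit x the indicators are eventually constant; the
      single exceptional point is null.\<close>
    show "AE t in U\<^sub>1. (\<lambda>n. indicator {..s n} t * g (t, y)) \<longlonglongrightarrow> indicator {..x} t * g (t, y)"
      using AE_unit_interval_neq[of x]
    proof eventually_elim
      case (elim t)
      have "\<forall>\<^sub>F n in sequentially. indicator {..s n} t = (indicator {..x} t :: complex)"
      proof (cases "t < x")
        case True
        show ?thesis by (rule eventually_mono[OF order_tendstoD(1)[OF s True]]) (use True in auto)
      next
        case False
        with elim have "x < t" by simp
        show ?thesis by (rule eventually_mono[OF order_tendstoD(2)[OF s \<open>x < t\<close>]]) (use \<open>x < t\<close> in auto)
      qed
      then show ?case
        by (intro tendsto_mult tendsto_const tendsto_eventually)
    qed
  qed (use i in \<open>auto split: split_indicator\<close>)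
  then show "((\<lambda>x. prim g (x, y)) \<circ> s) \<longlonglongrightarrow> prim g (x, y)"
    by (simp add: prim_def o_def)
qed

section \<open>Weak derivatives\<close>

abbreviation dx :: "(real \<times> real \<Rightarrow> complex) \<Rightarrow> real \<times> real \<Rightarrow> complex" where
  "dx \<phi> z \<equiv> frechet_derivative \<phi> (at z) (1, 0)"

lemma test_function_differentiable:
  assumes "test_function \<phi>"
  shows "\<phi> differentiable (at z)"
  using assms C_k.simps(2)[of 0 \<phi>] unfolding test_function_def by blast

lemma continuous_on_test_function:
  assumes "test_function \<phi>"
  shows "continuous_on UNIV \<phi>" "continuous_on UNIV (dx \<phi>)"
proof -
  have b: "(1, 0) \<in> (Basis :: (real \<times> real) set)" by (simp add: Basis_prod_def)
  show "continuous_on UNIV \<phi>"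
    using assms C_k.simps(1)[of \<phi>] unfolding test_function_def by blast
  have "C_k (Suc 0) \<phi>" using assms unfolding test_function_def by blast
  then have "C_k 0 (dx \<phi>)" using b unfolding C_k.simps(2) by blast
  then show "continuous_on UNIV (dx \<phi>)" by simp
qed

lemma test_function_eq_0:
  assumes "test_function \<phi>" "z \<notin> {0<..<1} \<times> {0<..<1}"
  shows "\<phi> z = 0"
  using assms unfolding test_function_def by blast

lemma test_function_has_vector_derivative:
  assumes "test_function \<phi>"
  shows "((\<lambda>x. \<phi> (x, y)) has_vector_derivative dx \<phi> (x, y)) (at x within S)"
proof -
  have D: "(\<phi> has_derivative frechet_derivative \<phi> (at (x, y))) (at (x, y))"
    using test_function_differentiable[OF assms] by (simp add: frechet_derivative_works)
  have "((\<lambda>x. (x, y)) has_derivative (\<lambda>h. (h, 0))) (at x)"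
    by (auto intro!: derivative_eq_intros)
  from has_derivative_compose[OF this D]
  have "((\<lambda>x. \<phi> (x, y)) has_derivative (\<lambda>h. frechet_derivative \<phi> (at (x, y)) (h, 0))) (at x)" .
  moreover have "frechet_derivative \<phi> (at (x, y)) (h, 0) = h *\<^sub>R dx \<phi> (x, y)" for h
    using linear_cmul[OF linear_frechet_derivative[OF test_function_differentiable[OF assms, of "(x, y)"]], of h "(1, 0)"]
    by simp
  ultimately show ?thesis
    unfolding has_vector_derivative_def by (metis (no_types, lifting) ext has_derivative_at_withinI)
qed

lemma continuous_on_slice:
  assumes "continuous_on UNIV (f :: real \<times> real \<Rightarrow> complex)"
  shows "continuous_on S (\<lambda>x. f (x, y))"
  by (rule continuous_on_compose2[OF assms]) (auto intro!: continuous_intros)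

text \<open>The fundamental theorem of calculus on the interval from t to 1, where the upper
  boundary term vanishes by compact support. The indicator is in the form left behind by exchanging
  the order of integration in \<open>integral_prim_mult\<close>.\<close>

lemma integral_dx_test_function:
  assumes \<phi>: "test_function \<phi>" and t: "t \<in> {0..1}"
  shows "(\<integral>x. indicator {..x} t * dx \<phi> (x, y) \<partial>U\<^sub>1) = - \<phi> (t, y)"
proof -
  have c: "continuous_on S (\<lambda>x. dx \<phi> (x, y))" for S
    by (rule continuous_on_slice[OF continuous_on_test_function(2)[OF \<phi>]])
  have "(\<integral>x. indicator {..x} t * dx \<phi> (x, y) \<partial>U\<^sub>1) =
      (\<integral>x. indicator {0..1} x *\<^sub>R (indicator {..x} t * dx \<phi> (x, y)) \<partial>lborel)"
    unfolding unit_cube_measure_def by (subst integral_restrict_space) auto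
  also have "\<dots> = (\<integral>x\<in>{t..1}. dx \<phi> (x, y) \<partial>lborel)"
    unfolding set_lebesgue_integral_def
    using t by (intro Bochner_Integration.integral_cong) (auto split: split_indicator)
  also have "\<dots> = integral {t..1} (\<lambda>x. dx \<phi> (x, y))"
    by (rule set_borel_integral_eq_integral(2)[OF borel_integrable_atLeastAtMost'[OF c]])
  also have "\<dots> = \<phi> (1, y) - \<phi> (t, y)"
    using t by (intro integral_unique fundamental_theorem_of_calculus
        test_function_has_vector_derivative[OF \<phi>]) auto
  also have "\<phi> (1, y) = 0"
    by (rule test_function_eq_0[OF \<phi>]) auto
  finally show ?thesis by simp
qed

text \<open>The counterpart of \<open>has_weak_dx\<close> for functions, so that explicit formulas
  can be differentiated without reference to the representatives picked by
  \<open>rep_L2\<close>.\<close>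

definition weak_dx :: "(real \<times> real \<Rightarrow> complex) \<Rightarrow> (real \<times> real \<Rightarrow> complex) \<Rightarrow> bool" where
  "weak_dx F G \<longleftrightarrow> (\<forall>\<phi>. test_function \<phi> \<longrightarrow>
     (\<integral>z. F z * dx \<phi> z \<partial>U\<^sub>2) = - (\<integral>z. G z * \<phi> z \<partial>U\<^sub>2))"

text \<open>Fubini on the triangle t \<le> x. With \<open>k\<close> the x-derivative of a test
  function this becomes integration by parts for a primitive that need not be differentiable
  everywhere.\<close>

lemma integral_prim_mult:
  assumes g: "integrable U\<^sub>1 (\<lambda>t. g (t, y))" and k: "continuous_on UNIV k"
  shows "(\<integral>x. prim g (x, y) * k x \<partial>U\<^sub>1) = (\<integral>t. g (t, y) * (\<integral>x. indicator {..x} t * k x \<partial>U\<^sub>1) \<partial>U\<^sub>1)"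
proof -
  let ?f = "\<lambda>x t. indicator {..x} t * (g (t, y) * k x)"
  have [measurable]: "(\<lambda>t. g (t, y)) \<in> borel_measurable U\<^sub>1" using g by auto
  have [measurable]: "k \<in> borel_measurable U\<^sub>1"
    using k by (intro measurable_unit_cube_measure_borel borel_measurable_continuous_onI)
  have i1: "integrable U\<^sub>2 (\<lambda>z. g (snd z, y))"
    by (rule integrable_snd_unit_square(1)[OF g])
  have "continuous_on UNIV (\<lambda>z::real \<times> real. k (fst z))"
    by (rule continuous_on_compose2[OF k]) (auto intro!: continuous_intros)
  from integrable_mult_continuous[OF i1 this]
  have i2: "integrable (U\<^sub>1 \<Otimes>\<^sub>M U\<^sub>1) (\<lambda>z. g (snd z, y) * k (fst z))"
    by (simp only: unit_cube_measure_prod)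
  have [measurable]: "(\<lambda>x. x) \<in> measurable U\<^sub>1 borel"
    by (rule measurable_unit_cube_measure_borel) simp
  have m: "(\<lambda>p. of_bool (snd p \<le> fst p) :: complex) \<in> borel_measurable (U\<^sub>1 \<Otimes>\<^sub>M U\<^sub>1)"
  proof -
    have "(\<lambda>p. snd p) \<in> borel_measurable (U\<^sub>1 \<Otimes>\<^sub>M U\<^sub>1)"
      by (rule measurable_compose[OF measurable_snd]) measurable
    moreover have "(\<lambda>p. fst p) \<in> borel_measurable (U\<^sub>1 \<Otimes>\<^sub>M U\<^sub>1)"
      by (rule measurable_compose[OF measurable_fst]) measurable
    ultimately have "Measurable.pred (U\<^sub>1 \<Otimes>\<^sub>M U\<^sub>1) (\<lambda>p. snd p \<le> fst p)"
      by measurable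
    then show ?thesis unfolding of_bool_def by (intro measurable_If) auto
  qed
  have "integrable (U\<^sub>1 \<Otimes>\<^sub>M U\<^sub>1) (\<lambda>z. of_bool (snd z \<le> fst z) * (g (snd z, y) * k (fst z)))"
    by (rule Bochner_Integration.integrable_bound[OF i2])
      (use m i2 in \<open>auto simp: norm_mult\<close>)
  then have f: "integrable (U\<^sub>1 \<Otimes>\<^sub>M U\<^sub>1) (case_prod ?f)"
    by (simp add: case_prod_unfold indicator_def)
  have "(\<integral>x. prim g (x, y) * k x \<partial>U\<^sub>1) = (\<integral>x. (\<integral>t. ?f x t \<partial>U\<^sub>1) \<partial>U\<^sub>1)"
    unfolding prim_def fst_conv snd_conv
    by (intro Bochner_Integration.integral_cong refl) (simp flip: mult.assoc)
  also have "\<dots> = (\<integral>t. (\<integral>x. ?f x t \<partial>U\<^sub>1) \<partial>U\<^sub>1)"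
    by (rule unit_square.Fubini_integral[OF f, symmetric])
  also have "\<dots> = (\<integral>t. g (t, y) * (\<integral>x. indicator {..x} t * k x \<partial>U\<^sub>1) \<partial>U\<^sub>1)"
    by (intro Bochner_Integration.integral_cong refl)
      (simp add: mult.left_commute flip: integral_mult_right_zero)
  finally show ?thesis .
qed

lemma weak_dx_prim:
  assumes a: "square_integrable a" and g: "square_integrable g"
  shows "weak_dx (\<lambda>z. a (snd z) + prim g z) g"
  unfolding weak_dx_def
proof (intro allI impI)
  fix \<phi> assume \<phi>: "test_function \<phi>"
  note cont = continuous_on_test_function[OF \<phi>]
  have i1: "integrable U\<^sub>2 (\<lambda>z. (a (snd z) + prim g z) * dx \<phi> z)"
    by (intro integrable_mult_continuous cont square_integrable_imp_integrable square_integrable_add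
        square_integrable_snd a square_integrable_prim g)
  have i2: "integrable U\<^sub>2 (\<lambda>z. g z * \<phi> z)"
    by (intro integrable_mult_continuous cont square_integrable_imp_integrable g)
  \<comment> \<open>The case t = 0 of \<open>integral_dx_test_function\<close>; it removes the
    contribution of the part that is constant in x.\<close>
  have dx0: "(\<integral>x. dx \<phi> (x, y) \<partial>U\<^sub>1) = 0" for y
  proof -
    have "(\<integral>x. dx \<phi> (x, y) \<partial>U\<^sub>1) = (\<integral>x. indicator {..x} 0 * dx \<phi> (x, y) \<partial>U\<^sub>1)"
      by (intro Bochner_Integration.integral_cong) auto
    also have "\<dots> = - \<phi> (0, y)"
      by (rule integral_dx_test_function[OF \<phi>]) simp
    also have "\<dots> = 0" using test_function_eq_0[OF \<phi>, of "(0, y)"] by simp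
    finally show ?thesis .
  qed
  have slice: "AE y in U\<^sub>1. (\<integral>x. (a y + prim g (x, y)) * dx \<phi> (x, y) \<partial>U\<^sub>1) = - (\<integral>x. g (x, y) * \<phi> (x, y) \<partial>U\<^sub>1)"
    using AE_integrable_slice[OF square_integrable_imp_integrable[OF g]]
      AE_integrable_slice[OF square_integrable_imp_integrable[OF square_integrable_prim[OF g]]]
  proof eventually_elim
    case (elim y)
    have c: "continuous_on UNIV (\<lambda>x. dx \<phi> (x, y))"
      by (rule continuous_on_slice[OF cont(2)])
    have j1: "integrable U\<^sub>1 (\<lambda>x. a y * dx \<phi> (x, y))"
      by (intro integrable_mult_continuous c) simp
    have j2: "integrable U\<^sub>1 (\<lambda>x. prim g (x, y) * dx \<phi> (x, y))"
      by (intro integrable_mult_continuous c elim)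
    have "(\<integral>x. (a y + prim g (x, y)) * dx \<phi> (x, y) \<partial>U\<^sub>1) =
        a y * (\<integral>x. dx \<phi> (x, y) \<partial>U\<^sub>1) + (\<integral>x. prim g (x, y) * dx \<phi> (x, y) \<partial>U\<^sub>1)"
      using j1 j2 by (simp add: distrib_right)
    also have "\<dots> = (\<integral>t. g (t, y) * (\<integral>x. indicator {..x} t * dx \<phi> (x, y) \<partial>U\<^sub>1) \<partial>U\<^sub>1)"
      using integral_prim_mult[OF elim(1) c] by (simp add: dx0)
    also have "\<dots> = (\<integral>t. - (g (t, y) * \<phi> (t, y)) \<partial>U\<^sub>1)"
      using integral_dx_test_function[OF \<phi>]
      by (intro Bochner_Integration.integral_cong) auto
    finally show ?case by simp
  qed
  have "(\<integral>z. (a (snd z) + prim g z) * dx \<phi> z \<partial>U\<^sub>2) =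
      (\<integral>y. (\<integral>x. (a y + prim g (x, y)) * dx \<phi> (x, y) \<partial>U\<^sub>1) \<partial>U\<^sub>1)"
    by (subst integral_unit_square[OF i1]) simp
  also have "\<dots> = (\<integral>y. - (\<integral>x. g (x, y) * \<phi> (x, y) \<partial>U\<^sub>1) \<partial>U\<^sub>1)"
    using integrable_slice_integral[OF i1] integrable_slice_integral[OF i2]
    by (intro integral_cong_AE slice borel_measurable_uminus) auto
  also have "\<dots> = - (\<integral>z. g z * \<phi> z \<partial>U\<^sub>2)"
    by (simp add: integral_unit_square[OF i2])
  finally show "(\<integral>z. (a (snd z) + prim g z) * dx \<phi> z \<partial>U\<^sub>2) = - (\<integral>z. g z * \<phi> z \<partial>U\<^sub>2)" .
qed

section \<open>Exponential integrating factors\<close>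

lemma exp_has_vector_derivative:
  "((\<lambda>x::real. c * exp (\<zeta> * complex_of_real x)) has_vector_derivative (c * \<zeta>) * exp (\<zeta> * of_real x)) (at x)"
proof -
  have "((\<lambda>w. c * exp (\<zeta> * w)) has_field_derivative c * \<zeta> * exp (\<zeta> * of_real x)) (at (of_real x))"
    by (auto intro!: derivative_eq_intros)
  from has_vector_derivative_real_field[OF this] show ?thesis by (simp add: o_def)
qed

lemma C_k_exp: "C_k k (\<lambda>x::real. c * exp (\<zeta> * of_real x))"
proof (induction k arbitrary: c)
  case 0
  show ?case by (auto intro!: continuous_intros)
next
  case (Suc k)
  show ?case using exp_has_vector_derivative Suc.IH by (rule C_k_SucI)
qed

lemma C_k_exp_fst: "C_k k (\<lambda>z::real \<times> real. exp ((\<zeta>::complex) * of_real (fst z)))"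
  using C_k_coordinate[OF bounded_linear_fst C_k_exp[of k 1 \<zeta>]] by simp

lemma continuous_on_exp_fst: "continuous_on UNIV (\<lambda>z::real \<times> real. exp ((\<zeta>::complex) * of_real (fst z)))"
  by (intro continuous_intros)

text \<open>The smooth factor is moved onto the test function: its product with a test function is a
  test function again, and the classical product rule there gives the Leibniz rule for the weak
  derivative.\<close>

lemma weak_dx_exp_mult:
  assumes F: "square_integrable F" and G: "square_integrable G" and FG: "weak_dx F G"
  shows "weak_dx (\<lambda>z. F z * exp (\<zeta> * of_real (fst z)))
      (\<lambda>z. G z * exp (\<zeta> * of_real (fst z)) + \<zeta> * (F z * exp (\<zeta> * of_real (fst z))))"
  unfolding weak_dx_def
proof (intro allI impI)
  let ?w = "\<lambda>z::real \<times> real. exp ((\<zeta>::complex) * of_real (fst z))"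
  fix \<phi> assume \<phi>: "test_function \<phi>"
  note cont = continuous_on_test_function[OF \<phi>]
  have w\<phi>: "test_function (\<lambda>z. ?w z * \<phi> z)"
  proof -
    have "C_k k \<phi>" for k
      using \<phi> unfolding test_function_def by blast
    then have "C_k k (\<lambda>z. ?w z * \<phi> z)" for k
      by (rule C_k_mult[OF C_k_exp_fst])
    moreover obtain K where "compact K" "K \<subseteq> {0<..<1} \<times> {0<..<1}" "\<And>z. z \<notin> K \<Longrightarrow> \<phi> z = 0"
      using \<phi> unfolding test_function_def by blast
    ultimately show ?thesis unfolding test_function_def by (metis mult_zero_right)
  qed
  have D: "dx (\<lambda>z. ?w z * \<phi> z) z = ?w z * dx \<phi> z + \<zeta> * ?w z * \<phi> z" for z
  proof -
    have "(\<phi> has_derivative frechet_derivative \<phi> (at z)) (at z)"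
      using test_function_differentiable[OF \<phi>] by (simp add: frechet_derivative_works)
    moreover have "(?w has_derivative (\<lambda>h. \<zeta> * of_real (fst h) * ?w z)) (at z)"
      using has_derivative_compose[OF bounded_linear_imp_has_derivative[OF bounded_linear_fst]
          exp_has_vector_derivative[of 1 \<zeta> "fst z", unfolded has_vector_derivative_def]]
      by (simp add: scaleR_conv_of_real ac_simps)
    ultimately have "((\<lambda>z. ?w z * \<phi> z) has_derivative
        (\<lambda>h. ?w z * frechet_derivative \<phi> (at z) h + \<zeta> * of_real (fst h) * ?w z * \<phi> z)) (at z)"
      by (intro has_derivative_mult)
    from frechet_derivative_at[OF this, symmetric] show ?thesis by simp
  qed
  have i: "integrable U\<^sub>2 (\<lambda>z. F z * (?w z * dx \<phi> z))" "integrable U\<^sub>2 (\<lambda>z. F z * (?w z * \<phi> z))"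
    "integrable U\<^sub>2 (\<lambda>z. G z * (?w z * \<phi> z))"
    by (intro integrable_mult_continuous square_integrable_imp_integrable F G continuous_on_mult
        continuous_on_exp_fst cont)+
  have "(\<integral>z. F z * (?w z * dx \<phi> z + \<zeta> * ?w z * \<phi> z) \<partial>U\<^sub>2) = - (\<integral>z. G z * (?w z * \<phi> z) \<partial>U\<^sub>2)"
    using FG w\<phi> unfolding weak_dx_def D[symmetric] by blast
  moreover have "(\<integral>z. F z * (?w z * dx \<phi> z + \<zeta> * ?w z * \<phi> z) \<partial>U\<^sub>2) =
      (\<integral>z. F z * (?w z * dx \<phi> z) + \<zeta> * (F z * (?w z * \<phi> z)) \<partial>U\<^sub>2)"
    by (intro Bochner_Integration.integral_cong refl) (simp add: algebra_simps)
  moreover have "(\<integral>z. (G z * ?w z + \<zeta> * (F z * ?w z)) * \<phi> z \<partial>U\<^sub>2) =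
      (\<integral>z. G z * (?w z * \<phi> z) + \<zeta> * (F z * (?w z * \<phi> z)) \<partial>U\<^sub>2)"
    by (intro Bochner_Integration.integral_cong refl) (simp add: algebra_simps)
  ultimately show "(\<integral>z. F z * ?w z * dx \<phi> z \<partial>U\<^sub>2) =
      - (\<integral>z. (G z * ?w z + \<zeta> * (F z * ?w z)) * \<phi> z \<partial>U\<^sub>2)"
    using i by (simp add: mult.assoc algebra_simps)
qed

section \<open>Uniqueness of weak derivatives and functions with weak derivative zero\<close>

lemma test_function_tensor:
  fixes u v :: "real \<Rightarrow> complex"
  assumes u: "\<And>k. C_k k u" "\<And>x. x \<notin> {p..q} \<Longrightarrow> u x = 0" "0 < p" "q < 1"
    and v: "\<And>k. C_k k v" "\<And>y. y \<notin> {r..s} \<Longrightarrow> v y = 0" "0 < r" "s < 1"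
  shows "test_function (\<lambda>z. u (fst z) * v (snd z))"
  unfolding test_function_def
proof (intro conjI allI exI[of _ "{p..q} \<times> {r..s}"] impI)
  show "C_k k (\<lambda>z::real \<times> real. u (fst z) * v (snd z))" for k
    by (rule C_k_mult[OF C_k_coordinate[OF bounded_linear_fst u(1)] C_k_coordinate[OF bounded_linear_snd v(1)]])
  show "compact ({p..q} \<times> {r..s})" by (intro compact_Times compact_Icc)
  show "{p..q} \<times> {r..s} \<subseteq> {0<..<1} \<times> {0<..<1}" using u v by auto
  show "u (fst z) * v (snd z) = 0" if "z \<notin> {p..q} \<times> {r..s}" for z
    using that u(2)[of "fst z"] v(2)[of "snd z"] by (auto simp: mem_Times_iff)
qed

lemma dx_tensor:
  fixes u v :: "real \<Rightarrow> complex"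
  assumes "(u has_vector_derivative u') (at (fst z))" "v differentiable (at (snd z))"
  shows "dx (\<lambda>z. u (fst z) * v (snd z)) z = u' * v (snd z)"
proof -
  have "((\<lambda>z. u (fst z)) has_derivative (\<lambda>h. fst h *\<^sub>R u')) (at z)"
    using has_derivative_compose[OF bounded_linear_imp_has_derivative[OF bounded_linear_fst] assms(1)[unfolded has_vector_derivative_def]] .
  moreover have "((\<lambda>z. v (snd z)) has_derivative (\<lambda>h. frechet_derivative v (at (snd z)) (snd h))) (at z)"
    using has_derivative_compose[OF bounded_linear_imp_has_derivative[OF bounded_linear_snd] assms(2)[unfolded frechet_derivative_works]] .
  ultimately have "((\<lambda>z. u (fst z) * v (snd z)) has_derivative
      (\<lambda>h. u (fst z) * frechet_derivative v (at (snd z)) (snd h) + fst h *\<^sub>R u' * v (snd z))) (at z)"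
    by (rule has_derivative_mult)
  from frechet_derivative_at[OF this, symmetric]
  have "dx (\<lambda>z. u (fst z) * v (snd z)) z = u (fst z) * frechet_derivative v (at (snd z)) 0 + u' * v (snd z)"
    by simp
  then show ?thesis
    using linear_0[OF linear_frechet_derivative[OF assms(2)]] by simp
qed

lemma bump_support:
  fixes a b :: real
  assumes "0 \<le> a" "b \<le> 1"
  shows "x \<notin> {1 / real (Suc n)..1 - 1 / real (Suc n)} \<Longrightarrow> bump n a b x = 0"
  using assms by (intro bump_eq_0) auto

lemma weak_dx_unique:
  assumes sq: "square_integrable F" "square_integrable G" "square_integrable G'"
    and "weak_dx F G" "weak_dx F G'"
  shows "AE z in U\<^sub>2. G z = G' z"
proof -
  have i: "integrable U\<^sub>2 G" "integrable U\<^sub>2 G'"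
    using sq by (auto intro: square_integrable_imp_integrable)
  have "AE z in U\<^sub>2. G z - G' z = 0"
  proof (rule AE_eq_0_if_bump_integrals_eq_0)
    show "integrable U\<^sub>2 (\<lambda>z. G z - G' z)" using i by (rule Bochner_Integration.integrable_diff)
    fix n and a b c d :: real
    assume *: "0 \<le> a" "b \<le> 1" "0 \<le> c" "d \<le> 1"
    let ?\<phi> = "\<lambda>z. complex_of_real (bump n a b (fst z)) * complex_of_real (bump n c d (snd z))"
    have t: "test_function ?\<phi>"
      by (rule test_function_tensor[where p="1 / real (Suc n)" and q="1 - 1 / real (Suc n)"
            and r="1 / real (Suc n)" and s="1 - 1 / real (Suc n)"])
        (use * in \<open>auto intro!: C_k_bump bump_support simp del: of_nat_Suc\<close>)
    have "(\<integral>z. G z * ?\<phi> z \<partial>U\<^sub>2) = (\<integral>z. G' z * ?\<phi> z \<partial>U\<^sub>2)"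
      using assms(4)[unfolded weak_dx_def, rule_format, OF t] assms(5)[unfolded weak_dx_def, rule_format, OF t]
      by (simp only: neg_equal_iff_equal)
    moreover have "integrable U\<^sub>2 (\<lambda>z. G z * ?\<phi> z)" "integrable U\<^sub>2 (\<lambda>z. G' z * ?\<phi> z)"
      by (intro integrable_mult_continuous i continuous_on_test_function[OF t])+
    ultimately show "(\<integral>z. (G z - G' z) * complex_of_real (bump n a b (fst z) * bump n c d (snd z)) \<partial>U\<^sub>2) = 0"
      by (simp add: left_diff_distrib)
  qed
  then show ?thesis by simp
qed

text \<open>Mean zero is what brings the primitive back to 0 to the right of the support, so that it
  can again be used in a test function.\<close>

lemma smooth_antiderivative:
  fixes h :: "real \<Rightarrow> complex"
  assumes h: "continuous_on UNIV h" "\<And>x. x \<notin> {p..q} \<Longrightarrow> h x = 0" "0 < p" "q < 1"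
    and zero: "integral {0..1} h = 0"
  shows "\<exists>H. (\<forall>x. (H has_vector_derivative h x) (at x)) \<and> (\<forall>x. x \<notin> {p..q} \<longrightarrow> H x = 0)"
proof (intro exI conjI allI impI)
  let ?H = "\<lambda>x. integral {0..x} h"
  have c: "continuous_on S h" for S using h(1) by (rule continuous_on_subset) auto
  have left: "?H x = 0" if "x < p" for x
  proof -
    have "integral {0..x} h = integral {0..x} (\<lambda>_. 0)"
      using that h(2) by (intro Henstock_Kurzweil_Integration.integral_cong) auto
    then show ?thesis by simp
  qed
  have right0: "integral {x..y} h = 0" if "q < x" for x y
  proof -
    have "integral {x..y} h = integral {x..y} (\<lambda>_. 0)"
      using that h(2) by (intro Henstock_Kurzweil_Integration.integral_cong) auto
    then show ?thesis by simp
  qed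
  show "?H x = 0" if "x \<notin> {p..q}" for x
  proof (cases "x < p")
    case False
    then have "q < x" "0 < x" using that h(3) by auto
    show ?thesis
    proof (cases "x \<le> 1")
      case True
      have "?H x + integral {x..1} h = integral {0..1} h"
        using True \<open>0 < x\<close> by (intro Henstock_Kurzweil_Integration.integral_combine integrable_continuous_real c) auto
      then show ?thesis using right0[OF \<open>q < x\<close>] zero by simp
    next
      case False
      have "integral {0..1} h + integral {1..x} h = ?H x"
        using False by (intro Henstock_Kurzweil_Integration.integral_combine integrable_continuous_real c) auto
      then show ?thesis using right0[of 1 x] h(4) zero by simp
    qed
  qed (rule left)
  show "(?H has_vector_derivative h x) (at x)" for x
  proof (cases "x < p")
    case True
    have "((\<lambda>_. 0) has_vector_derivative h x) (at x)"
      using h(2)[of x] True by simp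
    then show ?thesis
      by (rule has_vector_derivative_transform_within_open[where S="{..<p}"]) (use True left in auto)
  next
    case False
    \<comment> \<open>The primitive starts at 0, so it is differentiated inside an interval to the
      right of 0; the end x + 1 merely makes x an interior point.\<close>
    then have x: "x \<in> {0<..<x + 1}" using h(3) by auto
    have "(?H has_vector_derivative h x) (at x within {0..x + 1})"
      using x by (intro integral_has_vector_derivative c) auto
    then have "(?H has_vector_derivative h x) (at x within {0<..<x + 1})"
      by (rule has_vector_derivative_within_subset) auto
    then show ?thesis by (simp only: at_within_open[OF x open_greaterThanLessThan])
  qed
qed

text \<open>With index 3 both factors have the argument 4 * (1 / 2) - 1 = 1 at the midpoint, so the
  bump is positive there, and a nonnegative continuous function with integral zero would
  vanish.\<close>

lemma integral_bump_nonzero: "(\<integral>x. complex_of_real (bump 3 0 1 x) \<partial>U\<^sub>1) \<noteq> 0"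
proof
  assume z: "(\<integral>x. complex_of_real (bump 3 0 1 x) \<partial>U\<^sub>1) = 0"
  have c: "continuous_on S (\<lambda>x. complex_of_real (bump 3 0 1 x))" for S
    using C_k_bump[of 0 3 0 1] by (auto intro: continuous_on_subset)
  have i: "integrable U\<^sub>1 (bump 3 0 1)"
    using integrable_Re[OF integral_unit_interval_eq(1)[OF c]] by simp
  have "AE x in U\<^sub>1. bump 3 0 1 x = 0"
    using z i by (subst integral_nonneg_eq_0_iff_AE[symmetric]) (auto simp: bump_bounds)
  then have "complex_of_real (bump 3 0 1 (1 / 2)) = 0"
    by (intro continuous_AE_eq_0[OF c]) auto
  then show False by (simp add: bump_def flat_def)
qed

text \<open>
  Testing against \<open>\<Psi>'(x) \<eta>(y)\<close>, where \<open>\<Psi>' = \<psi> - c \<psi>\<^sub>0\<close> for a fixed bump \<open>\<psi>\<^sub>0\<close> and \<open>c\<close>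
  chosen so that \<open>\<Psi>'\<close> has mean zero, shows that \<open>u\<close> acts like its \<open>\<psi>\<^sub>0\<close>-average over \<open>x\<close>.
\<close>

lemma weak_dx_zero:
  assumes u: "square_integrable u" and zero: "weak_dx u (\<lambda>_. 0)"
  shows "\<exists>a. square_integrable a \<and> (AE z in U\<^sub>2. u z = a (snd z))"
proof -
  define \<psi>0 where "\<psi>0 = (\<lambda>x. complex_of_real (bump 3 0 1 x))"
  define c0 where "c0 = integral\<^sup>L U\<^sub>1 \<psi>0"
  have c0: "c0 \<noteq> 0"
    unfolding c0_def \<psi>0_def by (rule integral_bump_nonzero)
  have bump_cont: "continuous_on S (\<lambda>x. complex_of_real (bump n a b x))" for S n a b
    using C_k_bump[of 0 n a b] by (auto intro: continuous_on_subset)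
  have \<psi>0_cont: "continuous_on S \<psi>0" for S
    unfolding \<psi>0_def by (rule bump_cont)
  have tensor_cont: "continuous_on UNIV (\<lambda>z::real \<times> real. f (fst z) * g (snd z))"
    if "continuous_on UNIV f" "continuous_on UNIV g" for f g :: "real \<Rightarrow> complex"
  proof (rule continuous_on_mult)
    show "continuous_on UNIV (\<lambda>z::real \<times> real. f (fst z))"
      by (rule continuous_on_compose2[OF that(1)]) (auto intro!: continuous_intros)
    show "continuous_on UNIV (\<lambda>z::real \<times> real. g (snd z))"
      by (rule continuous_on_compose2[OF that(2)]) (auto intro!: continuous_intros)
  qed
  \<comment> \<open>The weight has integral 1 over x, so the slice integral of \<open>U\<close> is
    the average of \<open>u\<close>; if \<open>u\<close> depends on y alone, it is returned
    unchanged.\<close>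
  define U where "U = (\<lambda>z. u z * (\<psi>0 (fst z) / c0))"
  have U: "square_integrable U"
  proof -
    have "continuous_on UNIV (\<lambda>x. \<psi>0 x / c0)"
      by (intro continuous_on_divide \<psi>0_cont continuous_on_const) (simp add: c0)
    from tensor_cont[OF this continuous_on_const[of _ 1]] show ?thesis
      unfolding U_def by (intro square_integrable_mult_continuous u) simp
  qed
  define A where "A = (\<lambda>y. \<integral>t. U (t, y) \<partial>U\<^sub>1)"
  \<comment> \<open>Writing the average as a primitive at x = 1 yields its square
    integrability.\<close>
  have A_eq: "A = (\<lambda>y. prim U (1, y))"
    unfolding A_def prim_def by (intro ext Bochner_Integration.integral_cong) auto
  have A: "square_integrable A"
    unfolding A_eq by (rule square_integrable_prim_slice[OF U]) simp
  have iu: "integrable U\<^sub>2 u" by (rule square_integrable_imp_integrable[OF u])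
  have iA: "integrable U\<^sub>2 (\<lambda>z. A (snd z))"
    by (rule square_integrable_imp_integrable[OF square_integrable_snd[OF A]])
  have "AE z in U\<^sub>2. u z - A (snd z) = 0"
  proof (rule AE_eq_0_if_bump_integrals_eq_0)
    show "integrable U\<^sub>2 (\<lambda>z. u z - A (snd z))"
      using iu iA by (rule Bochner_Integration.integrable_diff)
    fix n and a b c d :: real
    assume *: "0 \<le> a" "b \<le> 1" "0 \<le> c" "d \<le> 1"
    define \<psi> where "\<psi> = (\<lambda>x. complex_of_real (bump n a b x))"
    define \<eta> where "\<eta> = (\<lambda>y. complex_of_real (bump n c d y))"
    have cont: "continuous_on S \<psi>" "continuous_on S \<eta>" for S
      unfolding \<psi>_def \<eta>_def by (rule bump_cont)+
    define m where "m = integral\<^sup>L U\<^sub>1 \<psi> / c0"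
    define h where "h = (\<lambda>x. \<psi> x + (- m) * \<psi>0 x)"
    have hC: "C_k k h" for k
      unfolding h_def \<psi>_def \<psi>0_def by (intro C_k_add C_k_mult C_k_const C_k_bump)
    have h_cont: "continuous_on S h" for S
      using hC[of 0] continuous_on_subset[of UNIV h S] by simp
    \<comment> \<open>A common margin for both bumps: 1 / (n + 1) for \<open>\<psi>\<close> and 1 /
      4 for \<open>\<psi>0\<close>, whose index is 3.\<close>
    define p where "p = min (1 / real (Suc n)) (1 / 4)"
    have p: "0 < p" unfolding p_def by simp
    have h0: "h x = 0" if "x \<notin> {p..1 - p}" for x
    proof -
      have le: "p \<le> 1 / real (Suc n)" "p \<le> 1 / real (Suc 3)" unfolding p_def by auto
      have "bump n a b x = 0"
        using that le(1) by (intro bump_support[OF *(1,2)]) (auto simp del: of_nat_Suc)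
      moreover have "bump 3 0 1 x = 0"
        using that le(2) by (intro bump_support) auto
      ultimately show ?thesis unfolding h_def \<psi>_def \<psi>0_def by simp
    qed
    have "integral\<^sup>L U\<^sub>1 h = integral\<^sup>L U\<^sub>1 \<psi> - m * c0"
      unfolding h_def c0_def using integral_unit_interval_eq(1)[OF cont(1)] integral_unit_interval_eq(1)[OF \<psi>0_cont]
      by simp
    then have "integral {0..1} h = 0"
      using integral_unit_interval_eq(2)[OF h_cont] c0 by (simp add: m_def)
    then obtain H where H: "\<And>x. (H has_vector_derivative h x) (at x)" "\<And>x. x \<notin> {p..1 - p} \<Longrightarrow> H x = 0"
      using smooth_antiderivative[of h p "1 - p"] h_cont h0 p by auto
    have HC: "C_k k H" for k
      by (rule C_k_Suc_imp[OF C_k_SucI[OF H(1) hC]])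
    have t: "test_function (\<lambda>z. H (fst z) * \<eta> (snd z))"
    proof (rule test_function_tensor[OF HC H(2) p])
      show "C_k k \<eta>" for k unfolding \<eta>_def by (rule C_k_bump)
      show "\<eta> y = 0" if "y \<notin> {1 / real (Suc n)..1 - 1 / real (Suc n)}" for y
        unfolding \<eta>_def using bump_support[OF *(3,4) that] by simp
    qed (use p in auto)
    have \<eta>_diff: "\<eta> differentiable (at y)" for y
      using C_k_bump[of "Suc 0" n c d] unfolding \<eta>_def by simp
    have "(\<integral>z. u z * dx (\<lambda>z. H (fst z) * \<eta> (snd z)) z \<partial>U\<^sub>2) = 0"
      using zero t unfolding weak_dx_def by simp
    then have "(\<integral>z. u z * (h (fst z) * \<eta> (snd z)) \<partial>U\<^sub>2) = 0"
      by (simp only: dx_tensor[OF H(1) \<eta>_diff])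
    moreover have "(\<integral>z. u z * (h (fst z) * \<eta> (snd z)) \<partial>U\<^sub>2) =
        (\<integral>z. u z * (\<psi> (fst z) * \<eta> (snd z)) - m * (u z * (\<psi>0 (fst z) * \<eta> (snd z))) \<partial>U\<^sub>2)"
      by (intro Bochner_Integration.integral_cong refl) (simp add: h_def algebra_simps)
    moreover have i: "integrable U\<^sub>2 (\<lambda>z. u z * (\<psi> (fst z) * \<eta> (snd z)))"
      "integrable U\<^sub>2 (\<lambda>z. u z * (\<psi>0 (fst z) * \<eta> (snd z)))"
      "integrable U\<^sub>2 (\<lambda>z. A (snd z) * (\<psi> (fst z) * \<eta> (snd z)))"
      by (rule integrable_mult_continuous[OF iu tensor_cont[OF cont(1) cont(2)]]
          integrable_mult_continuous[OF iu tensor_cont[OF \<psi>0_cont cont(2)]]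
          integrable_mult_continuous[OF iA tensor_cont[OF cont(1) cont(2)]])+
    ultimately have 1: "(\<integral>z. u z * (\<psi> (fst z) * \<eta> (snd z)) \<partial>U\<^sub>2) =
        m * (\<integral>z. u z * (\<psi>0 (fst z) * \<eta> (snd z)) \<partial>U\<^sub>2)"
      by simp
    have "(\<integral>z. u z * (\<psi>0 (fst z) * \<eta> (snd z)) \<partial>U\<^sub>2) = (\<integral>y. (\<integral>x. c0 * \<eta> y * U (x, y) \<partial>U\<^sub>1) \<partial>U\<^sub>1)"
      unfolding integral_unit_square[OF i(2)]
      by (intro Bochner_Integration.integral_cong refl) (simp add: U_def c0)
    also have "\<dots> = c0 * (\<integral>y. \<eta> y * A y \<partial>U\<^sub>1)"
      by (simp add: A_def mult.assoc)
    finally have 2: "(\<integral>z. u z * (\<psi>0 (fst z) * \<eta> (snd z)) \<partial>U\<^sub>2) = c0 * (\<integral>y. \<eta> y * A y \<partial>U\<^sub>1)" .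
    have "(\<integral>z. A (snd z) * (\<psi> (fst z) * \<eta> (snd z)) \<partial>U\<^sub>2) = (\<integral>y. (\<integral>x. (\<eta> y * A y) * \<psi> x \<partial>U\<^sub>1) \<partial>U\<^sub>1)"
      unfolding integral_unit_square[OF i(3)]
      by (intro Bochner_Integration.integral_cong refl) simp
    also have "\<dots> = (\<integral>y. \<eta> y * A y \<partial>U\<^sub>1) * integral\<^sup>L U\<^sub>1 \<psi>"
      by simp
    finally have "(\<integral>z. A (snd z) * (\<psi> (fst z) * \<eta> (snd z)) \<partial>U\<^sub>2) = (\<integral>z. u z * (\<psi> (fst z) * \<eta> (snd z)) \<partial>U\<^sub>2)"
      using 1 2 c0 by (simp add: m_def)
    then have "(\<integral>z. (u z - A (snd z)) * (\<psi> (fst z) * \<eta> (snd z)) \<partial>U\<^sub>2) = 0"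
      using i by (simp add: left_diff_distrib)
    then show "(\<integral>z. (u z - A (snd z)) * complex_of_real (bump n a b (fst z) * bump n c d (snd z)) \<partial>U\<^sub>2) = 0"
      by (simp add: \<psi>_def \<eta>_def)
  qed
  with A show ?thesis by auto
qed

lemma weak_dx_diff:
  assumes "square_integrable F" "square_integrable G" "square_integrable F'" "square_integrable G'"
    and "weak_dx F G" "weak_dx F' G'"
  shows "weak_dx (\<lambda>z. F z - F' z) (\<lambda>z. G z - G' z)"
  unfolding weak_dx_def
proof (intro allI impI)
  fix \<phi> assume \<phi>: "test_function \<phi>"
  note cont = continuous_on_test_function[OF \<phi>]
  have i: "integrable U\<^sub>2 (\<lambda>z. F z * dx \<phi> z)" "integrable U\<^sub>2 (\<lambda>z. F' z * dx \<phi> z)"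
    "integrable U\<^sub>2 (\<lambda>z. G z * \<phi> z)" "integrable U\<^sub>2 (\<lambda>z. G' z * \<phi> z)"
    by (intro integrable_mult_continuous square_integrable_imp_integrable assms cont)+
  then show "(\<integral>z. (F z - F' z) * dx \<phi> z \<partial>U\<^sub>2) = - (\<integral>z. (G z - G' z) * \<phi> z \<partial>U\<^sub>2)"
    using assms(5,6) \<phi> unfolding weak_dx_def by (simp add: left_diff_distrib)
qed

text \<open>\<open>F\<close> and \<open>prim G\<close> have the same weak derivative, so their
  difference has weak derivative zero and is a function of y.\<close>

lemma weak_dx_imp_prim:
  assumes F: "square_integrable F" and G: "square_integrable G" and FG: "weak_dx F G"
  shows "\<exists>a. square_integrable a \<and> (AE z in U\<^sub>2. F z = a (snd z) + prim G z)"
proof -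
  have P: "square_integrable (prim G)" by (rule square_integrable_prim[OF G])
  have "weak_dx (\<lambda>z. 0 + prim G z) G"
    using weak_dx_prim[OF square_integrable_zero G] by simp
  then have "weak_dx (\<lambda>z. F z - prim G z) (\<lambda>z. G z - G z)"
    using weak_dx_diff[OF F G P G FG] by simp
  moreover have "square_integrable (\<lambda>z. F z - prim G z)"
    using square_integrable_add[OF F square_integrable_scaleC[OF P, of "- 1"]] by simp
  ultimately obtain a where "square_integrable a" "AE z in U\<^sub>2. F z - prim G z = a (snd z)"
    using weak_dx_zero[of "\<lambda>z. F z - prim G z"] by auto
  then show ?thesis
    by (intro exI[of _ a]) (auto elim!: eventually_mono simp: diff_eq_eq)
qed

section \<open>Weak derivatives and boundary values of \<open>L\<^sup>2\<close> classes\<close>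

lemma square_integrable_rep_L2: "square_integrable (rep_L2 f)"
  using Quotient3_rep_reflp[OF Quotient3_L2, of f] by (simp add: L2_rel_def)

lemma abs_L2_rep_L2 [simp]: "abs_L2 (rep_L2 f) = f"
  by (rule Quotient3_abs_rep[OF Quotient3_L2])

lemma abs_L2_eq_iff:
  assumes "square_integrable F" "square_integrable G"
  shows "abs_L2 F = abs_L2 G \<longleftrightarrow> (AE x in unit_cube_measure. F x = G x)"
  using Quotient3_rel[OF Quotient3_L2, of F G] assms by (auto simp: L2_rel_def)

lemma AE_rep_L2_abs_L2:
  assumes "square_integrable F"
  shows "AE x in unit_cube_measure. rep_L2 (abs_L2 F) x = F x"
  using abs_L2_eq_iff[OF square_integrable_rep_L2[of "abs_L2 F"] assms] by simp

lemma square_integrable_diff: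
  assumes "square_integrable F" "square_integrable G"
  shows "square_integrable (\<lambda>x. F x - G x)"
  using square_integrable_add[OF assms(1) square_integrable_scaleC[OF assms(2), of "- 1"]] by simp

lemma abs_L2_add:
  assumes "square_integrable F" "square_integrable G"
  shows "abs_L2 F + abs_L2 G = abs_L2 (\<lambda>x. F x + G x)"
  by (rule plus_L2.abs_eq) (use assms in \<open>auto simp: L2_rel_def\<close>)

lemma abs_L2_scaleC:
  assumes "square_integrable F"
  shows "c *\<^sub>C abs_L2 F = abs_L2 (\<lambda>x. c * F x)"
  by (rule scaleC_L2.abs_eq) (use assms in \<open>auto simp: L2_rel_def\<close>)

lemma abs_L2_diff:
  assumes "square_integrable F" "square_integrable G"
  shows "abs_L2 F - abs_L2 G = abs_L2 (\<lambda>x. F x - G x)"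
  using abs_L2_add[OF assms(1) square_integrable_scaleC[OF assms(2), of "- 1"]]
  by (simp add: minus_L2_def uminus_L2_def abs_L2_scaleC[OF assms(2)])

lemma norm_abs_L2_power2:
  assumes "square_integrable F"
  shows "(norm (abs_L2 F))\<^sup>2 = (\<integral>x. (cmod (F x))\<^sup>2 \<partial>unit_cube_measure)"
proof -
  have "cinner (abs_L2 F) (abs_L2 F) = (\<integral>x. cnj (F x) * F x \<partial>unit_cube_measure)"
    by (rule cinner_L2.abs_eq) (use assms in \<open>auto simp: L2_rel_def\<close>)
  then have "inner (abs_L2 F) (abs_L2 F) = (\<integral>x. (cmod (F x))\<^sup>2 \<partial>unit_cube_measure)"
    by (simp add: inner_L2_def integral_cnj_mult_self)
  then show ?thesis
    by (simp add: power2_norm_eq_inner)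
qed

lemma norm_abs_L2_le:
  assumes F: "square_integrable F" and G: "square_integrable G" and B: "0 \<le> B"
    and le: "(\<integral>x. (cmod (F x))\<^sup>2 \<partial>unit_cube_measure) \<le> B\<^sup>2 * (\<integral>x. (cmod (G x))\<^sup>2 \<partial>unit_cube_measure)"
  shows "norm (abs_L2 F) \<le> B * norm (abs_L2 G)"
  using le B unfolding norm_abs_L2_power2[OF F, symmetric] norm_abs_L2_power2[OF G, symmetric]
  by - (rule power2_le_imp_le, auto simp: power_mult_distrib)

lemma norm_abs_L2_mult_le:
  assumes F: "square_integrable F" and k: "continuous_on UNIV k"
    and B: "\<And>x. x \<in> cbox 0 One \<Longrightarrow> cmod (k x) \<le> B"
  shows "norm (abs_L2 (\<lambda>x. F x * k x)) \<le> B * norm (abs_L2 F)"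
proof (rule norm_abs_L2_le)
  show sq: "square_integrable (\<lambda>x. F x * k x)" "square_integrable F"
    using F k by (auto intro: square_integrable_mult_continuous)
  show "0 \<le> B" using order.trans[OF norm_ge_zero B[of 0]] by (simp add: mem_box)
  have "(\<integral>x. (cmod (F x * k x))\<^sup>2 \<partial>unit_cube_measure) \<le> (\<integral>x. B\<^sup>2 * (cmod (F x))\<^sup>2 \<partial>unit_cube_measure)"
  proof (rule integral_mono)
    show "integrable unit_cube_measure (\<lambda>x. (cmod (F x * k x))\<^sup>2)"
      using sq unfolding square_integrable_def by blast
    show "integrable unit_cube_measure (\<lambda>x. B\<^sup>2 * (cmod (F x))\<^sup>2)"
      using F unfolding square_integrable_def by (intro integrable_mult_right) blast
    fix x :: 'a assume "x \<in> space unit_cube_measure"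
    then have "cmod (k x) \<le> B" using B by simp
    then have "(cmod (k x))\<^sup>2 \<le> B\<^sup>2" by (rule power_mono) simp
    then show "(cmod (F x * k x))\<^sup>2 \<le> B\<^sup>2 * (cmod (F x))\<^sup>2"
      unfolding norm_mult power_mult_distrib by (subst mult.commute) (intro mult_right_mono, auto)
  qed
  then show "(\<integral>x. (cmod (F x * k x))\<^sup>2 \<partial>unit_cube_measure) \<le> B\<^sup>2 * (\<integral>x. (cmod (F x))\<^sup>2 \<partial>unit_cube_measure)"
    by simp
qed

text \<open>Both follow by integrating the slicewise bound of the primitive by
  \<open>slice_energy\<close> over y; the constant is 1 because the interval has length 1.\<close>

lemma norm_abs_L2_prim_le:
  assumes g: "square_integrable g"
  shows "norm (abs_L2 (prim g)) \<le> norm (abs_L2 g)"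
    and "norm (abs_L2 (\<lambda>y. prim g (1, y))) \<le> norm (abs_L2 g)"
proof -
  note e = integrable_slice_energy[OF g]
  note sq = square_integrable_prim[OF g] square_integrable_prim_slice[OF g, of 1, simplified]
  have "(\<integral>z. (cmod (prim g z))\<^sup>2 \<partial>U\<^sub>2) \<le> (\<integral>z. slice_energy g (snd z) \<partial>U\<^sub>2)"
  proof (rule integral_mono_AE)
    show "integrable U\<^sub>2 (\<lambda>z. (cmod (prim g z))\<^sup>2)"
      using sq(1) unfolding square_integrable_def by blast
    show "integrable U\<^sub>2 (\<lambda>z. slice_energy g (snd z))"
      by (rule integrable_snd_unit_square(1)[OF e(1)])
    show "AE z in U\<^sub>2. (cmod (prim g z))\<^sup>2 \<le> slice_energy g (snd z)"
      using AE_snd_unit_square[OF AE_norm_prim_power2_le[OF g]]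
      by eventually_elim (metis prod.collapse)
  qed
  then have 1: "(\<integral>z. (cmod (prim g z))\<^sup>2 \<partial>U\<^sub>2) \<le> (\<integral>z. (cmod (g z))\<^sup>2 \<partial>U\<^sub>2)"
    using integrable_snd_unit_square(2)[OF e(1)] e(2) by simp
  show "norm (abs_L2 (prim g)) \<le> norm (abs_L2 g)"
    using norm_abs_L2_le[OF sq(1) g, of 1] 1 by simp
  have "(\<integral>y. (cmod (prim g (1, y)))\<^sup>2 \<partial>U\<^sub>1) \<le> (\<integral>y. slice_energy g y \<partial>U\<^sub>1)"
  proof (rule integral_mono_AE)
    show "integrable U\<^sub>1 (\<lambda>y. (cmod (prim g (1, y)))\<^sup>2)"
      using sq(2) unfolding square_integrable_def by blast
    show "integrable U\<^sub>1 (slice_energy g)" by (rule e(1))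
    show "AE y in U\<^sub>1. (cmod (prim g (1, y)))\<^sup>2 \<le> slice_energy g y"
      using AE_norm_prim_power2_le[OF g] by eventually_elim blast
  qed
  then have "(norm (abs_L2 (\<lambda>y. prim g (1, y))))\<^sup>2 \<le> (norm (abs_L2 g))\<^sup>2"
    unfolding norm_abs_L2_power2[OF sq(2)] norm_abs_L2_power2[OF g] e(2) .
  then show "norm (abs_L2 (\<lambda>y. prim g (1, y))) \<le> norm (abs_L2 g)"
    by (rule power2_le_imp_le) simp
qed

lemma norm_abs_L2_snd:
  fixes a :: "real \<Rightarrow> complex"
  assumes a: "square_integrable a"
  shows "norm (abs_L2 (\<lambda>z::real \<times> real. a (snd z))) = norm (abs_L2 a)"
proof -
  have "integrable U\<^sub>1 (\<lambda>y. (cmod (a y))\<^sup>2)" using a unfolding square_integrable_def by blast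
  then have "(norm (abs_L2 (\<lambda>z::real \<times> real. a (snd z))))\<^sup>2 = (norm (abs_L2 a))\<^sup>2"
    unfolding norm_abs_L2_power2[OF a] norm_abs_L2_power2[OF square_integrable_snd[OF a]]
    by (rule integrable_snd_unit_square(2))
  then show ?thesis by simp
qed

text \<open>The difference has total energy zero, which is the integral of its nonnegative slice
  energies; hence almost every slice has energy zero.\<close>

lemma AE_slice_eq:
  assumes F: "square_integrable F" and G: "square_integrable G" and FG: "AE z in U\<^sub>2. F z = G z"
  shows "AE y in U\<^sub>1. AE x in U\<^sub>1. F (x, y) = G (x, y)"
proof -
  let ?d = "\<lambda>z. F z - G z"
  have d: "square_integrable ?d" by (rule square_integrable_diff[OF F G])
  have "integral\<^sup>L U\<^sub>1 (slice_energy ?d) = (\<integral>z. (cmod (?d z))\<^sup>2 \<partial>U\<^sub>2)"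
    by (rule integrable_slice_energy(2)[OF d])
  also have "\<dots> = 0"
    using FG by (intro integral_eq_zero_AE) (auto elim!: eventually_mono)
  finally have "integral\<^sup>L U\<^sub>1 (slice_energy ?d) = 0" .
  then have "AE y in U\<^sub>1. slice_energy ?d y = 0"
    using integral_nonneg_eq_0_iff_AE[OF integrable_slice_energy(1)[OF d]]
    by (simp add: slice_energy_def)
  then show ?thesis
    using AE_square_integrable_slice[OF d]
  proof eventually_elim
    case (elim y)
    then have i: "integrable U\<^sub>1 (\<lambda>x. (cmod (?d (x, y)))\<^sup>2)"
      unfolding square_integrable_def by blast
    have "AE x in U\<^sub>1. (cmod (?d (x, y)))\<^sup>2 = 0"
      using integral_nonneg_eq_0_iff_AE[OF i] elim(1) by (simp add: slice_energy_def)
    then show ?case by eventually_elim simp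
  qed
qed

lemma has_weak_dx_abs_L2:
  assumes F: "square_integrable F" and G: "square_integrable G"
  shows "has_weak_dx (abs_L2 F) (abs_L2 G) \<longleftrightarrow> weak_dx F G"
proof -
  have "(\<integral>z. rep_L2 (abs_L2 H) z * k z \<partial>U\<^sub>2) = (\<integral>z. H z * k z \<partial>U\<^sub>2)"
    if H: "square_integrable H" and k: "continuous_on UNIV k" for H k
  proof (rule integral_cong_AE)
    show "AE z in U\<^sub>2. rep_L2 (abs_L2 H) z * k z = H z * k z"
      using AE_rep_L2_abs_L2[OF H] by eventually_elim simp
  qed (intro borel_measurable_integrable integrable_mult_continuous k square_integrable_imp_integrable
      square_integrable_rep_L2 H)+
  then show ?thesis
    unfolding has_weak_dx_def weak_dx_def using F G continuous_on_test_function by auto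
qed

lemma has_weak_dx_iff: "has_weak_dx f g \<longleftrightarrow> weak_dx (rep_L2 f) (rep_L2 g)"
  unfolding has_weak_dx_def weak_dx_def ..

lemma has_weak_dx_unique:
  assumes "has_weak_dx f g" "has_weak_dx f g'"
  shows "g = g'"
proof -
  have "abs_L2 (rep_L2 g) = abs_L2 (rep_L2 g')"
    unfolding abs_L2_eq_iff[OF square_integrable_rep_L2 square_integrable_rep_L2]
    using assms unfolding has_weak_dx_iff by (rule weak_dx_unique[OF square_integrable_rep_L2 square_integrable_rep_L2 square_integrable_rep_L2])
  then show ?thesis by simp
qed

text \<open>Equality almost everywhere on the square says nothing on the line x = c. On almost every
  slice, however, two admissible representatives are both continuous and agree almost everywhere,
  hence also at \<open>c\<close>.\<close>

lemma has_boundary_value_unique: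
  assumes "has_boundary_value f c a" "has_boundary_value f c b" and c: "c \<in> {0..1}"
  shows "a = b"
proof -
  obtain F where F: "square_integrable F" "abs_L2 F = f"
      "AE y in U\<^sub>1. continuous_on {0..1} (\<lambda>x. F (x, y))"
      "square_integrable (\<lambda>y. F (c, y))" "abs_L2 (\<lambda>y. F (c, y)) = a"
    using assms(1) unfolding has_boundary_value_def by blast
  obtain G where G: "square_integrable G" "abs_L2 G = f"
      "AE y in U\<^sub>1. continuous_on {0..1} (\<lambda>x. G (x, y))"
      "square_integrable (\<lambda>y. G (c, y))" "abs_L2 (\<lambda>y. G (c, y)) = b"
    using assms(2) unfolding has_boundary_value_def by blast
  have "AE z in U\<^sub>2. F z = G z"
    using abs_L2_eq_iff[OF F(1) G(1)] F(2) G(2) by simp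
  from AE_slice_eq[OF F(1) G(1) this] F(3) G(3)
  have "AE y in U\<^sub>1. F (c, y) = G (c, y)"
  proof eventually_elim
    case (elim y)
    have "F (c, y) - G (c, y) = 0"
    proof (rule continuous_AE_eq_0[OF _ _ c])
      show "continuous_on {0..1} (\<lambda>x. F (x, y) - G (x, y))"
        using elim by (intro continuous_on_diff)
      show "AE x in U\<^sub>1. F (x, y) - G (x, y) = 0"
        using elim(1) by eventually_elim simp
    qed
    then show ?case by simp
  qed
  then show ?thesis
    using abs_L2_eq_iff[OF F(4) G(4)] F(5) G(5) by simp
qed

lemma boundary_value_eqI:
  assumes "has_boundary_value f c a" "c \<in> {0..1}"
  shows "boundary_value c f = a"
  unfolding boundary_value_def
  using assms has_boundary_value_unique by (intro the_equality) blast+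

text \<open>
  Multiplication by \<open>exp (- \<zeta> x)\<close> with \<open>\<zeta> = i 2\<pi> z\<close> turns \<open>(P - z) f = g\<close> into an equation of the form
  \<open>\<partial>\<^sub>x F = G\<close>; the right-hand side is \<open>resolvent_source\<close>.
\<close>

definition freq :: "complex \<Rightarrow> complex" where
  "freq z = \<i> * 2 * complex_of_real pi * z"

definition resolvent_source :: "complex \<Rightarrow> (real \<times> real \<Rightarrow> complex) \<Rightarrow> real \<times> real \<Rightarrow> complex" where
  "resolvent_source z g p = freq 1 * (g p * exp (- freq z * of_real (fst p)))"

definition resolvent_solution ::
    "complex \<Rightarrow> (real \<Rightarrow> complex) \<Rightarrow> (real \<times> real \<Rightarrow> complex) \<Rightarrow> real \<times> real \<Rightarrow> complex" where
  "resolvent_solution z a g p =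
     (a (snd p) + prim (resolvent_source z g) p) * exp (freq z * of_real (fst p))"

lemma freq_1_nonzero: "freq 1 \<noteq> 0" by (simp add: freq_def)

lemma freq_mult: "freq z = freq 1 * z" by (simp add: freq_def)

lemma exp_freq_cancel: "exp (- freq z * x) * exp (freq z * x) = 1"
  by (simp flip: exp_add)

lemma square_integrable_resolvent_source:
  "square_integrable g \<Longrightarrow> square_integrable (resolvent_source z g)"
  unfolding resolvent_source_def[abs_def]
  by (rule square_integrable_scaleC[OF square_integrable_mult_continuous[OF _ continuous_on_exp_fst]])

lemma square_integrable_resolvent_solution:
  assumes "square_integrable a" "square_integrable g"
  shows "square_integrable (resolvent_solution z a g)"
  unfolding resolvent_solution_def[abs_def]
  by (rule square_integrable_mult_continuous[OF square_integrable_add[OF square_integrable_snd[OF assms(1)]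
        square_integrable_prim[OF square_integrable_resolvent_source[OF assms(2)]]] continuous_on_exp_fst])

text \<open>The Leibniz rule applied to exp(\<zeta> x): this factor cancels the one in the source,
  leaving \<open>freq 1\<close> times \<open>g\<close>, and its own derivative produces the term
  with \<open>z\<close>.\<close>

lemma weak_dx_resolvent_solution:
  assumes a: "square_integrable a" and g: "square_integrable g"
  shows "weak_dx (resolvent_solution z a g) (\<lambda>p. freq 1 * (z * resolvent_solution z a g p + g p))"
proof -
  note s = square_integrable_resolvent_source[OF g, of z]
  let ?E = "\<lambda>p::real \<times> real. exp (freq z * of_real (fst p))"
  have "weak_dx (\<lambda>p. (a (snd p) + prim (resolvent_source z g) p) * ?E p)
      (\<lambda>p. resolvent_source z g p * ?E p + freq z * ((a (snd p) + prim (resolvent_source z g) p) * ?E p))"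
    by (rule weak_dx_exp_mult[OF square_integrable_add[OF square_integrable_snd[OF a] square_integrable_prim[OF s]] s
          weak_dx_prim[OF a s]])
  moreover have "resolvent_source z g p * ?E p + freq z * ((a (snd p) + prim (resolvent_source z g) p) * ?E p) =
      freq 1 * (z * resolvent_solution z a g p + g p)" for p
  proof -
    have "resolvent_source z g p * ?E p = freq 1 * g p * (exp (- freq z * of_real (fst p)) * ?E p)"
      by (simp only: resolvent_source_def mult.assoc)
    then have "resolvent_source z g p * ?E p = freq 1 * g p"
      by (simp only: exp_freq_cancel mult_1_right)
    then show ?thesis
      unfolding resolvent_solution_def by (simp only: freq_mult[of z]) (simp add: algebra_simps)
  qed
  ultimately show ?thesis
    by (simp only: resolvent_solution_def[abs_def])
qed

text \<open>Multiplying by exp(- \<zeta> x) cancels the zeroth order term, so what remains is the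
  statement that a function with known weak derivative is a primitive plus a function of y.\<close>

lemma weak_dx_imp_resolvent_solution:
  assumes f: "square_integrable f" and g: "square_integrable g"
    and wd: "weak_dx f (\<lambda>p. freq 1 * (z * f p + g p))"
  shows "\<exists>a. square_integrable a \<and> (AE p in U\<^sub>2. f p = resolvent_solution z a g p)"
proof -
  let ?E = "\<lambda>p::real \<times> real. exp (- freq z * of_real (fst p))"
  have fE: "square_integrable (\<lambda>p. f p * ?E p)"
    by (rule square_integrable_mult_continuous[OF f continuous_on_exp_fst])
  have G: "square_integrable (\<lambda>p. freq 1 * (z * f p + g p))"
    by (intro square_integrable_scaleC square_integrable_add f g)
  have "freq 1 * (z * f p + g p) * ?E p + - freq z * (f p * ?E p) = resolvent_source z g p" for p
    unfolding resolvent_source_def freq_mult[of z] by (simp add: algebra_simps)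
  then have "weak_dx (\<lambda>p. f p * ?E p) (resolvent_source z g)"
    using weak_dx_exp_mult[OF f G wd, of "- freq z"] by simp
  then obtain a where a: "square_integrable a"
    "AE p in U\<^sub>2. f p * ?E p = a (snd p) + prim (resolvent_source z g) p"
    using weak_dx_imp_prim[OF fE square_integrable_resolvent_source[OF g]] by blast
  have "f p = f p * ?E p * exp (freq z * of_real (fst p))" for p
    using exp_freq_cancel[of z "of_real (fst p)"] by (simp only: mult.assoc mult_1_right)
  note f_eq = this
  have "AE p in U\<^sub>2. f p = resolvent_solution z a g p"
    using a(2) unfolding resolvent_solution_def
  proof eventually_elim
    case (elim p)
    then show ?case using f_eq[of p] by (simp only:)
  qed
  with a(1) show ?thesis by blast
qed

lemma AE_continuous_on_resolvent_solution:
  assumes g: "square_integrable g"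
  shows "AE y in U\<^sub>1. continuous_on {0..1} (\<lambda>x. resolvent_solution z a g (x, y))"
  using AE_integrable_slice[OF square_integrable_imp_integrable[OF square_integrable_resolvent_source[OF g, of z]]]
proof eventually_elim
  case (elim y)
  show ?case
    unfolding resolvent_solution_def fst_conv snd_conv
    by (intro continuous_on_mult continuous_on_add continuous_on_const continuous_on_prim[OF elim]
        continuous_on_exp continuous_on_of_real continuous_on_id)
qed

lemma resolvent_solution_0: "resolvent_solution z a g (0, y) = a y"
  by (simp add: resolvent_solution_def prim_0)

lemma resolvent_solution_1:
  "resolvent_solution z a g (1, y) = exp (freq z) * (a y + prim (resolvent_source z g) (1, y))"
  by (simp add: resolvent_solution_def mult.commute)

section \<open>Completeness and resolvents\<close>

lemma cinner_scaleC_left: "cinner (c *\<^sub>C x) y = cnj c * cinner (x :: 'a::complex_inner) y"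
  using cinner_commute[of "c *\<^sub>C x" y] cinner_commute[of y x] by (simp add: cinner_scaleC_right)

lemma norm_scaleC: "norm (c *\<^sub>C (x :: 'a::complex_inner)) = cmod c * norm x"
proof -
  have "cinner (c *\<^sub>C x) (c *\<^sub>C x) = (c * cnj c) * cinner x x"
    by (simp only: cinner_scaleC_left cinner_scaleC_right ac_simps)
  also have "c * cnj c = complex_of_real ((cmod c)\<^sup>2)"
    by (rule complex_norm_square[symmetric])
  finally have "Re (cinner (c *\<^sub>C x) (c *\<^sub>C x)) = (cmod c)\<^sup>2 * Re (cinner x x)"
    by (simp only: Re_complex_of_real Im_complex_of_real times_complex.sel mult_zero_left diff_zero)
  then have "(norm (c *\<^sub>C x))\<^sup>2 = (cmod c * norm x)\<^sup>2"
    by (simp only: power2_norm_eq_inner inner_eq_Re_cinner power_mult_distrib)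
  then show ?thesis by simp
qed

lemma scaleC_minus_right: "c *\<^sub>C (x - y) = c *\<^sub>C x - c *\<^sub>C (y :: 'a::complex_inner)"
  using scaleC_add_right[of c "x - y" y] by (simp add: eq_diff_eq)

lemma scaleC_cancel: "c \<noteq> 0 \<Longrightarrow> c *\<^sub>C x = c *\<^sub>C y \<longleftrightarrow> x = (y :: 'a::complex_inner)"
  by (metis left_inverse scaleC_one scaleC_scaleC)

lemma scaleC_inverse:
  fixes x :: "'a::complex_inner"
  assumes "c \<noteq> 0"
  shows "c *\<^sub>C (1 / c) *\<^sub>C x = x" "(1 / c) *\<^sub>C c *\<^sub>C x = x"
  using assms by (simp_all add: scaleC_scaleC scaleC_one)

lemma unitary_diff:
  fixes V :: "'a::complex_inner \<Rightarrow> 'b::complex_inner"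
  assumes "unitary V"
  shows "V (x - y) = V x - V y"
proof -
  have "V ((x - y) + y) = V (x - y) + V y"
    using assms unfolding unitary_def Vector_Spaces.linear_def module_hom_def module_hom_axioms_def by blast
  then show ?thesis by (simp add: eq_diff_eq)
qed

lemma norm_unitary:
  fixes V :: "'a::complex_inner \<Rightarrow> 'b::complex_inner"
  assumes "unitary V"
  shows "norm (V x) = norm x"
  using assms unfolding unitary_def norm_eq_sqrt_inner inner_eq_Re_cinner by simp

lemma bij_unitary:
  fixes V :: "'a::complex_inner \<Rightarrow> 'b::complex_inner"
  assumes "unitary V"
  shows "bij V"
proof (rule bijI)
  show "inj V"
  proof (rule injI)
    fix x y assume "V x = V y"
    then have "norm (x - y) = 0"
      using unitary_diff[OF assms, of x y] norm_unitary[OF assms, of "x - y"] by simp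
    then show "x = y" by simp
  qed
qed (use assms in \<open>simp add: unitary_def\<close>)

text \<open>
  Fischer--Riesz: along a subsequence with summable \<open>L\<^sup>2\<close> increments the increments are almost everywhere
  absolutely summable, because \<open>\<bar>d\<bar> \<le> 2\<^sup>-\<^sup>n + 2\<^sup>n \<bar>d\<bar>\<^sup>2\<close>; Fatou's lemma identifies the limit.
\<close>

lemma AE_convergent_if_norm_diff_le:
  fixes F :: "nat \<Rightarrow> 'a::euclidean_space \<Rightarrow> complex"
  assumes F: "\<And>n. square_integrable (F n)"
    and le: "\<And>n. norm (abs_L2 (F (Suc n)) - abs_L2 (F n)) \<le> (1 / 2) ^ n"
  shows "AE x in unit_cube_measure. convergent (\<lambda>n. F n x)"
proof -
  let ?M = "unit_cube_measure :: 'a measure"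
  define s where "s n x = 2 ^ n * (cmod (F (Suc n) x - F n x))\<^sup>2" for n x
  have s_nonneg: "0 \<le> s n x" for n x unfolding s_def by simp
  have d: "square_integrable (\<lambda>x. F (Suc n) x - F n x)" for n
    by (intro square_integrable_diff F)
  then have i: "integrable ?M (s n)" for n
    unfolding s_def square_integrable_def by (intro integrable_mult_right) blast
  have "(\<integral>\<^sup>+x. ennreal (s n x) \<partial>?M) \<le> ennreal ((1 / 2) ^ n)" for n
  proof -
    have "(\<integral>x. s n x \<partial>?M) = 2 ^ n * (norm (abs_L2 (F (Suc n)) - abs_L2 (F n)))\<^sup>2"
      unfolding s_def abs_L2_diff[OF F F] norm_abs_L2_power2[OF d] by simp
    also have "\<dots> \<le> 2 ^ n * ((1 / 2) ^ n)\<^sup>2"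
      by (intro mult_left_mono power_mono le) auto
    also have "\<dots> = (1 / 2) ^ n"
      by (simp add: power2_eq_square power_one_over)
    finally show ?thesis
      using i s_nonneg by (subst nn_integral_eq_integral) (auto intro: ennreal_leI)
  qed
  then have "(\<Sum>n. \<integral>\<^sup>+x. ennreal (s n x) \<partial>?M) \<le> (\<Sum>n. ennreal ((1 / 2) ^ n))"
    by (intro suminf_le) auto
  also have "\<dots> = ennreal (\<Sum>n. (1 / 2) ^ n)"
    by (rule suminf_ennreal2) (auto intro: summable_geometric)
  finally have "(\<integral>\<^sup>+x. (\<Sum>n. ennreal (s n x)) \<partial>?M) < \<infinity>"
    using i by (subst nn_integral_suminf) (auto simp: order_le_less_trans)
  then have "AE x in ?M. (\<Sum>n. ennreal (s n x)) \<noteq> \<infinity>"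
    using i by (intro nn_integral_noteq_infinite) auto
  then show ?thesis
  proof eventually_elim
    case (elim x)
    then have "summable (\<lambda>n. s n x)"
      using s_nonneg by (intro summable_suminf_not_top) auto
    then have "summable (\<lambda>n. (1 / 2) ^ n + s n x)"
      by (intro summable_add summable_geometric) auto
    then have "summable (\<lambda>n. F (Suc n) x - F n x)"
    proof (rule summable_comparison_test'[where N=0])
      fix n
      let ?d = "cmod (F (Suc n) x - F n x)"
      have "0 \<le> 2 ^ n * ?d" by simp
      then have "2 ^ n * ?d \<le> 1 + (2 ^ n * ?d)\<^sup>2"
        using sum_squares_bound[of 1 "2 ^ n * ?d"] unfolding power_one mult_1_right by linarith
      then have "?d \<le> (1 + (2 ^ n * ?d)\<^sup>2) / 2 ^ n"
        by (simp add: field_simps)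
      also have "\<dots> = (1 / 2) ^ n + s n x"
        by (simp add: s_def power2_eq_square field_simps)
      finally show "?d \<le> (1 / 2) ^ n + s n x" .
    qed
    then have "convergent (\<lambda>n. \<Sum>k<n. F (Suc k) x - F k x)"
      by (simp add: summable_iff_convergent)
    then have "convergent (\<lambda>n. F n x - F 0 x)"
      by (simp only: sum_lessThan_telescope[of "\<lambda>k. F k x"])
    then show ?case
      by (simp only: convergent_diff_const_right_iff)
  qed
qed

text \<open>Comparison with an arbitrary fixed \<open>G\<close>, instead of 0, lets one application
  of Fatou show both that the limit is square integrable and how fast it is approached, by taking
  \<open>G\<close> from the sequence.\<close>

lemma norm_abs_L2_limit_le:
  fixes F :: "nat \<Rightarrow> 'a::euclidean_space \<Rightarrow> complex"
  assumes F: "\<And>n. square_integrable (F n)" and G: "square_integrable G"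
    and L [measurable]: "L \<in> borel_measurable unit_cube_measure"
    and lim: "AE x in unit_cube_measure. (\<lambda>n. F n x) \<longlonglongrightarrow> L x"
    and le: "\<And>n. n \<ge> N \<Longrightarrow> norm (abs_L2 (F n) - abs_L2 G) \<le> c" and c: "0 \<le> c"
  shows "square_integrable L" "norm (abs_L2 L - abs_L2 G) \<le> c"
proof -
  let ?M = "unit_cube_measure :: 'a measure"
  have [measurable]: "F n \<in> borel_measurable ?M" "G \<in> borel_measurable ?M" for n
    using F G unfolding square_integrable_def by blast+
  have "(\<integral>\<^sup>+x. ennreal ((cmod (L x - G x))\<^sup>2) \<partial>?M) =
      (\<integral>\<^sup>+x. liminf (\<lambda>n. ennreal ((cmod (F n x - G x))\<^sup>2)) \<partial>?M)"
    using lim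
  proof (intro nn_integral_cong_AE, eventually_elim)
    case (elim x)
    then have "(\<lambda>n. ennreal ((cmod (F n x - G x))\<^sup>2)) \<longlonglongrightarrow> ennreal ((cmod (L x - G x))\<^sup>2)"
      by (intro tendsto_ennrealI tendsto_intros)
    from lim_imp_Liminf[OF sequentially_bot this] show ?case by (rule sym)
  qed
  also have "\<dots> \<le> liminf (\<lambda>n. \<integral>\<^sup>+x. ennreal ((cmod (F n x - G x))\<^sup>2) \<partial>?M)"
    by (rule nn_integral_liminf) measurable
  also have "\<dots> \<le> ennreal (c\<^sup>2)"
  proof -
    have "(\<integral>\<^sup>+x. ennreal ((cmod (F n x - G x))\<^sup>2) \<partial>?M) \<le> ennreal (c\<^sup>2)" if n: "n \<ge> N" for n
    proof -
      have d: "square_integrable (\<lambda>x. F n x - G x)" by (rule square_integrable_diff[OF F G])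
      have "(\<integral>x. (cmod (F n x - G x))\<^sup>2 \<partial>?M) = (norm (abs_L2 (F n) - abs_L2 G))\<^sup>2"
        unfolding abs_L2_diff[OF F G] norm_abs_L2_power2[OF d] ..
      also have "\<dots> \<le> c\<^sup>2" by (intro power_mono le n) simp
      finally show ?thesis
        using d unfolding square_integrable_def by (subst nn_integral_eq_integral) (auto intro: ennreal_leI)
    qed
    then have "liminf (\<lambda>n. \<integral>\<^sup>+x. ennreal ((cmod (F n x - G x))\<^sup>2) \<partial>?M) \<le> liminf (\<lambda>n. ennreal (c\<^sup>2))"
      by (intro Liminf_mono) (auto simp: eventually_sequentially)
    then show ?thesis by (simp add: Liminf_const)
  qed
  finally have nn: "(\<integral>\<^sup>+x. ennreal ((cmod (L x - G x))\<^sup>2) \<partial>?M) \<le> ennreal (c\<^sup>2)" .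
  have d: "square_integrable (\<lambda>x. L x - G x)"
    unfolding square_integrable_def
  proof
    show "integrable ?M (\<lambda>x. (cmod (L x - G x))\<^sup>2)"
      using nn by (intro integrableI_bounded) (auto simp: le_less_trans)
  qed measurable
  have "square_integrable (\<lambda>x. (L x - G x) + G x)"
    by (rule square_integrable_add[OF d G])
  then show L': "square_integrable L" by simp
  have "ennreal (\<integral>x. (cmod (L x - G x))\<^sup>2 \<partial>?M) \<le> ennreal (c\<^sup>2)"
    using nn d unfolding square_integrable_def by (subst nn_integral_eq_integral[symmetric]) auto
  then have "(norm (abs_L2 L - abs_L2 G))\<^sup>2 \<le> c\<^sup>2"
    unfolding abs_L2_diff[OF L' G] norm_abs_L2_power2[OF d] by (simp add: ennreal_le_iff)
  then show "norm (abs_L2 L - abs_L2 G) \<le> c"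
    using c by (rule power2_le_imp_le)
qed

instance L2 :: (euclidean_space) complete_space
proof
  fix X :: "nat \<Rightarrow> 'a L2"
  assume X: "Cauchy X"
  have "\<exists>M. \<forall>m\<ge>M. \<forall>n\<ge>M. norm (X m - X n) < (1 / 2) ^ k" for k :: nat
    using X unfolding Cauchy_def dist_norm by simp
  then obtain M where M: "\<And>k m n. m \<ge> M k \<Longrightarrow> n \<ge> M k \<Longrightarrow> norm (X m - X n) < (1 / 2) ^ k"
    by metis
  \<comment> \<open>The sum dominates every \<open>M k\<close> with k \<le> n, and the summand n
    makes the sequence strictly increasing.\<close>
  define r where "r n = n + (\<Sum>k\<le>n. M k)" for n
  have r: "strict_mono r"
    unfolding strict_mono_Suc_iff r_def by simp
  have rM: "M k \<le> r n" if "k \<le> n" for k n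
  proof -
    have "M k \<le> (\<Sum>k\<le>n. M k)" using that by (intro member_le_sum) auto
    then show ?thesis by (simp add: r_def)
  qed
  define F where "F n = rep_L2 (X (r n))" for n
  have F: "square_integrable (F n)" for n unfolding F_def by (rule square_integrable_rep_L2)
  have absF: "abs_L2 (F n) = X (r n)" for n unfolding F_def by simp
  have [measurable]: "F n \<in> borel_measurable unit_cube_measure" for n
    using F unfolding square_integrable_def by blast
  have conv: "AE x in unit_cube_measure. convergent (\<lambda>n. F n x)"
    by (rule AE_convergent_if_norm_diff_le[OF F]) (auto simp: absF intro!: less_imp_le M rM)
  define L where "L x = lim (\<lambda>n. F n x)" for x
  have L: "L \<in> borel_measurable unit_cube_measure"
    unfolding L_def[abs_def] by (rule borel_measurable_lim_metric) measurable
  have lim: "AE x in unit_cube_measure. (\<lambda>n. F n x) \<longlonglongrightarrow> L x"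
    using conv by eventually_elim (simp add: L_def convergent_LIMSEQ_iff)
  have le: "norm (abs_L2 L - X (r k)) \<le> (1 / 2) ^ k" for k
    using norm_abs_L2_limit_le(2)[OF F F L lim, of k k "(1 / 2) ^ k"]
    by (simp add: absF less_imp_le M rM)
  have "(\<lambda>k. X (r k)) \<longlonglongrightarrow> abs_L2 L"
  proof (rule metric_tendsto_imp_tendsto)
    show "(\<lambda>k. (1 / 2 :: real) ^ k) \<longlonglongrightarrow> 0"
      by (rule LIMSEQ_power_zero) simp
    show "\<forall>\<^sub>F k in sequentially. dist (X (r k)) (abs_L2 L) \<le> dist ((1 / 2 :: real) ^ k) 0"
      using le by (simp add: dist_norm norm_minus_commute)
  qed
  then show "convergent X"
    using Cauchy_converges_subseq[OF X r] unfolding convergent_def o_def by blast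
qed

lemma resolvent_set_unitary:
  fixes V :: "'a L2 \<Rightarrow> ('a::euclidean_space) L2"
  assumes V: "unitary V" and m: "cmod m \<noteq> 1"
  shows "m \<in> resolvent_set (UNIV, V)"
proof -
  have "\<exists>!a. V a - m *\<^sub>C a = w" for w
  proof (cases "cmod m < 1")
    case True
    \<comment> \<open>The equation is solved for the occurrence of \<open>a\<close> under
      \<open>V\<close>; since the inverse is isometric, the contraction constant is |m|.\<close>
    have eq: "V a - m *\<^sub>C a = w \<longleftrightarrow> inv V (w + m *\<^sub>C a) = a" for a
      using bij_unitary[OF V] by (metis bij_inv_eq_iff diff_eq_eq)
    have "dist (inv V (w + m *\<^sub>C a)) (inv V (w + m *\<^sub>C b)) \<le> cmod m * dist a b" for a b
    proof -
      have "norm (inv V x - inv V y) = norm (x - y)" for x y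
        using norm_unitary[OF V, of "inv V x - inv V y"] unitary_diff[OF V, of "inv V x" "inv V y"]
          surj_f_inv_f[OF bij_is_surj[OF bij_unitary[OF V]]] by simp
      then show ?thesis by (simp add: dist_norm norm_scaleC flip: scaleC_minus_right)
    qed
    then have "\<exists>!a. inv V (w + m *\<^sub>C a) = a"
      by (intro banach_fix_type[of "cmod m"]) (use True in auto)
    then show ?thesis by (simp only: eq)
  next
    case False
    with m have m1: "1 < cmod m" "m \<noteq> 0" by auto
    \<comment> \<open>Here the equation is solved for the other occurrence of \<open>a\<close>, with
      contraction constant 1 / |m|.\<close>
    have eq: "V a - m *\<^sub>C a = w \<longleftrightarrow> (1 / m) *\<^sub>C (V a - w) = a" for a
    proof -
      have "(1 / m) *\<^sub>C (V a - w) = a \<longleftrightarrow> m *\<^sub>C ((1 / m) *\<^sub>C (V a - w)) = m *\<^sub>C a"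
        by (simp only: scaleC_cancel[OF m1(2)])
      then show ?thesis unfolding scaleC_inverse[OF m1(2)] by (auto simp: algebra_simps)
    qed
    have "dist ((1 / m) *\<^sub>C (V a - w)) ((1 / m) *\<^sub>C (V b - w)) \<le> (1 / cmod m) * dist a b" for a b
      by (simp add: dist_norm norm_scaleC norm_divide norm_unitary[OF V]
          flip: scaleC_minus_right unitary_diff[OF V])
    then have "\<exists>!a. (1 / m) *\<^sub>C (V a - w) = a"
      by (intro banach_fix_type[of "1 / cmod m"]) (use m1 in auto)
    then show ?thesis by (simp only: eq)
  qed
  then have "bij (\<lambda>a. V a - m *\<^sub>C a)"
    unfolding bij_iff by (rule allI)
  \<comment> \<open>The reverse triangle inequality compares the lengths |a| and |m| |a| of the two
    terms.\<close>
  moreover have "norm a \<le> (1 / \<bar>1 - cmod m\<bar>) * norm (V a - m *\<^sub>C a)" for a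
  proof -
    have "\<bar>norm (V a) - norm (m *\<^sub>C a)\<bar> \<le> norm (V a - m *\<^sub>C a)"
      by (rule norm_triangle_ineq3)
    moreover have "norm (V a) - norm (m *\<^sub>C a) = (1 - cmod m) * norm a"
      by (simp add: norm_unitary[OF V] norm_scaleC algebra_simps)
    ultimately have "\<bar>1 - cmod m\<bar> * norm a \<le> norm (V a - m *\<^sub>C a)"
      by (simp only: abs_mult abs_norm_cancel)
    then show ?thesis
      using m by (simp add: pos_le_divide_eq mult.commute)
  qed
  ultimately show ?thesis
    unfolding resolvent_set_def by blast
qed

section \<open>Reduction of the resolvent equation to an equation for the boundary value at x =
  0\<close>

definition sol_L2 :: "complex \<Rightarrow> real L2 \<Rightarrow> (real \<times> real) L2 \<Rightarrow> (real \<times> real) L2" where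
  "sol_L2 z a g = abs_L2 (resolvent_solution z (rep_L2 a) (rep_L2 g))"

text \<open>The element h of the overview: the amount by which the source changes exp(- \<zeta> x) f
  between x = 0 and x = 1.\<close>

definition defect_L2 :: "complex \<Rightarrow> (real \<times> real) L2 \<Rightarrow> real L2" where
  "defect_L2 z g = abs_L2 (\<lambda>y. prim (resolvent_source z (rep_L2 g)) (1, y))"

lemmas square_integrable_source_rep =
  square_integrable_resolvent_source[OF square_integrable_rep_L2]
lemmas square_integrable_solution_rep =
  square_integrable_resolvent_solution[OF square_integrable_rep_L2 square_integrable_rep_L2]
lemmas square_integrable_defect =
  square_integrable_prim_slice[OF square_integrable_source_rep, of 1, simplified]

text \<open>\<open>freq 1\<close> is i 2 \<pi>, the reciprocal of the prefactor in
  \<open>P_max\<close>. Uniqueness of the weak derivative resolves the definite description in its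
  definition.\<close>

lemma P_max_eq_iff:
  "f \<in> fst P_max \<and> snd P_max f - z *\<^sub>C f = g \<longleftrightarrow> has_weak_dx f (freq 1 *\<^sub>C (z *\<^sub>C f + g))"
proof -
  have app: "snd P_max f = (1 / freq 1) *\<^sub>C h" if "has_weak_dx f h" for h
  proof -
    have "(THE h. has_weak_dx f h) = h"
      by (rule the_equality) (fact that, erule has_weak_dx_unique[OF _ that])
    then show ?thesis unfolding P_max_def freq_def by simp
  qed
  show ?thesis
  proof
    assume *: "f \<in> fst P_max \<and> snd P_max f - z *\<^sub>C f = g"
    then obtain h where h: "has_weak_dx f h" unfolding P_max_def by auto
    with * app[OF h] have "z *\<^sub>C f + g = (1 / freq 1) *\<^sub>C h" by (simp add: algebra_simps)
    then have "freq 1 *\<^sub>C (z *\<^sub>C f + g) = h" by (simp only: scaleC_inverse[OF freq_1_nonzero])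
    with h show "has_weak_dx f (freq 1 *\<^sub>C (z *\<^sub>C f + g))" by simp
  next
    assume *: "has_weak_dx f (freq 1 *\<^sub>C (z *\<^sub>C f + g))"
    then have "f \<in> fst P_max" unfolding P_max_def by auto
    moreover have "snd P_max f - z *\<^sub>C f = g"
      unfolding app[OF *] scaleC_inverse[OF freq_1_nonzero] by simp
    ultimately show "f \<in> fst P_max \<and> snd P_max f - z *\<^sub>C f = g" ..
  qed
qed

lemma has_weak_dx_sol_iff:
  "has_weak_dx f (freq 1 *\<^sub>C (z *\<^sub>C f + g)) \<longleftrightarrow> (\<exists>a. f = sol_L2 z a g)"
proof -
  have rhs: "freq 1 *\<^sub>C (z *\<^sub>C abs_L2 F + g) = abs_L2 (\<lambda>p. freq 1 * (z * F p + rep_L2 g p))"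
    and sq: "square_integrable (\<lambda>p. freq 1 * (z * F p + rep_L2 g p))" if F: "square_integrable F" for F
  proof -
    note zF = square_integrable_scaleC[OF F, of z]
    show "square_integrable (\<lambda>p. freq 1 * (z * F p + rep_L2 g p))"
      by (rule square_integrable_scaleC[OF square_integrable_add[OF zF square_integrable_rep_L2]])
    have "z *\<^sub>C abs_L2 F + g = abs_L2 (\<lambda>p. z * F p + rep_L2 g p)"
      using abs_L2_add[OF zF square_integrable_rep_L2[of g]] by (simp add: abs_L2_scaleC[OF F])
    then show "freq 1 *\<^sub>C (z *\<^sub>C abs_L2 F + g) = abs_L2 (\<lambda>p. freq 1 * (z * F p + rep_L2 g p))"
      by (simp only: abs_L2_scaleC[OF square_integrable_add[OF zF square_integrable_rep_L2]])
  qed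
  show ?thesis
  proof
    assume "has_weak_dx f (freq 1 *\<^sub>C (z *\<^sub>C f + g))"
    then have "has_weak_dx (abs_L2 (rep_L2 f)) (freq 1 *\<^sub>C (z *\<^sub>C abs_L2 (rep_L2 f) + g))"
      by simp
    then have "weak_dx (rep_L2 f) (\<lambda>p. freq 1 * (z * rep_L2 f p + rep_L2 g p))"
      unfolding rhs[OF square_integrable_rep_L2]
        has_weak_dx_abs_L2[OF square_integrable_rep_L2 sq[OF square_integrable_rep_L2]] .
    from weak_dx_imp_resolvent_solution[OF square_integrable_rep_L2 square_integrable_rep_L2 this]
    obtain a where a: "square_integrable a" "AE p in U\<^sub>2. rep_L2 f p = resolvent_solution z a (rep_L2 g) p"
      by blast
    \<comment> \<open>\<open>sol_L2\<close> uses the chosen representative of the class of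
      \<open>a\<close>; the exchange alters the formula only for a null set of y.\<close>
    have "AE p in U\<^sub>2. rep_L2 f p = resolvent_solution z (rep_L2 (abs_L2 a)) (rep_L2 g) p"
      using a(2) AE_snd_unit_square[OF AE_rep_L2_abs_L2[OF a(1)]]
      by eventually_elim (simp add: resolvent_solution_def)
    then have "abs_L2 (rep_L2 f) = sol_L2 z (abs_L2 a) g"
      unfolding sol_L2_def abs_L2_eq_iff[OF square_integrable_rep_L2 square_integrable_solution_rep] .
    then show "\<exists>a. f = sol_L2 z a g" by auto
  next
    assume "\<exists>a. f = sol_L2 z a g"
    then obtain a where f: "f = sol_L2 z a g" ..
    show "has_weak_dx f (freq 1 *\<^sub>C (z *\<^sub>C f + g))"
      unfolding f sol_L2_def rhs[OF square_integrable_solution_rep]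
        has_weak_dx_abs_L2[OF square_integrable_solution_rep sq[OF square_integrable_solution_rep]]
      by (rule weak_dx_resolvent_solution[OF square_integrable_rep_L2 square_integrable_rep_L2])
  qed
qed

lemma boundary_value_sol_0: "boundary_value 0 (sol_L2 z a g) = a"
proof (rule boundary_value_eqI)
  show "has_boundary_value (sol_L2 z a g) 0 a"
    unfolding has_boundary_value_def sol_L2_def
    by (intro exI[of _ "resolvent_solution z (rep_L2 a) (rep_L2 g)"] conjI refl square_integrable_solution_rep
        AE_continuous_on_resolvent_solution square_integrable_rep_L2)
      (simp_all add: resolvent_solution_0 square_integrable_rep_L2)
qed simp

lemma boundary_value_sol_1: "boundary_value 1 (sol_L2 z a g) = exp (freq z) *\<^sub>C (a + defect_L2 z g)"
proof (rule boundary_value_eqI)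
  let ?b = "\<lambda>y. rep_L2 a y + prim (resolvent_source z (rep_L2 g)) (1, y)"
  have b: "square_integrable ?b"
    by (rule square_integrable_add[OF square_integrable_rep_L2 square_integrable_defect])
  have "a + defect_L2 z g = abs_L2 ?b"
    using abs_L2_add[OF square_integrable_rep_L2[of a] square_integrable_defect[of z g]] by (simp add: defect_L2_def)
  then have *: "exp (freq z) *\<^sub>C (a + defect_L2 z g) = abs_L2 (\<lambda>y. exp (freq z) * ?b y)"
    by (simp only: abs_L2_scaleC[OF b])
  show "has_boundary_value (sol_L2 z a g) 1 (exp (freq z) *\<^sub>C (a + defect_L2 z g))"
    unfolding has_boundary_value_def sol_L2_def *
    by (intro exI[of _ "resolvent_solution z (rep_L2 a) (rep_L2 g)"] conjI refl square_integrable_solution_rep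
        AE_continuous_on_resolvent_solution square_integrable_rep_L2)
      (simp_all add: resolvent_solution_1 square_integrable_scaleC[OF b])
qed simp

text \<open>Both boundary values of a solution are explicit in \<open>a\<close>, so the boundary
  condition becomes an inhomogeneous equation for V - \<mu>. Stated for all \<open>f\<close> and
  \<open>g\<close> at once, it yields injectivity, surjectivity and the norm bound.\<close>

lemma P_ext_eq_iff:
  "f \<in> fst (P_ext V) \<and> snd (P_ext V) f - z *\<^sub>C f = g \<longleftrightarrow>
    (\<exists>a. f = sol_L2 z a g \<and> V a - exp (freq z) *\<^sub>C a = exp (freq z) *\<^sub>C defect_L2 z g)"
proof -
  have bc: "boundary_value 1 (sol_L2 z a g) = V (boundary_value 0 (sol_L2 z a g)) \<longleftrightarrow>
      V a - exp (freq z) *\<^sub>C a = exp (freq z) *\<^sub>C defect_L2 z g" for a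
    unfolding boundary_value_sol_0 boundary_value_sol_1 scaleC_add_right
    by (auto simp: diff_eq_eq add.commute)
  have "f \<in> fst (P_ext V) \<and> snd (P_ext V) f - z *\<^sub>C f = g \<longleftrightarrow>
      (f \<in> fst P_max \<and> snd P_max f - z *\<^sub>C f = g) \<and> boundary_value 1 f = V (boundary_value 0 f)"
    unfolding P_ext_def by auto
  also have "\<dots> \<longleftrightarrow> (\<exists>a. f = sol_L2 z a g) \<and> boundary_value 1 f = V (boundary_value 0 f)"
    unfolding P_max_eq_iff has_weak_dx_sol_iff ..
  also have "\<dots> \<longleftrightarrow> (\<exists>a. f = sol_L2 z a g \<and> V a - exp (freq z) *\<^sub>C a = exp (freq z) *\<^sub>C defect_L2 z g)"
    by (auto simp: bc)
  finally show ?thesis .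
qed

text \<open>From |exp w| \<le> exp |w|: one constant that bounds the integrating factor and its
  inverse on the whole square.\<close>

definition exp_bound :: "complex \<Rightarrow> real" where
  "exp_bound z = exp (cmod (freq z))"

lemma norm_exp_freq_le:
  fixes x :: "real \<times> real"
  assumes "x \<in> cbox 0 One"
  shows "cmod (exp (freq z * of_real (fst x))) \<le> exp_bound z"
    "cmod (exp (- freq z * of_real (fst x))) \<le> exp_bound z"
proof -
  have x: "0 \<le> fst x" "fst x \<le> 1"
    using assms by (auto simp: unit_cube_prod)
  have "cmod (w * of_real (fst x)) \<le> cmod w" for w
    using x by (simp add: norm_mult mult_left_le)
  from this[of "freq z"] this[of "- freq z"]
  show "cmod (exp (freq z * of_real (fst x))) \<le> exp_bound z"
    "cmod (exp (- freq z * of_real (fst x))) \<le> exp_bound z"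
    unfolding exp_bound_def using norm_exp[of "freq z * of_real (fst x)"] norm_exp[of "- freq z * of_real (fst x)"]
    by (simp_all add: order.trans)
qed

lemma norm_source_le:
  "norm (abs_L2 (resolvent_source z (rep_L2 g))) \<le> cmod (freq 1) * exp_bound z * norm g"
proof -
  let ?E = "\<lambda>p::real \<times> real. exp (- freq z * of_real (fst p))"
  have sq: "square_integrable (\<lambda>p. rep_L2 g p * ?E p)"
    by (rule square_integrable_mult_continuous[OF square_integrable_rep_L2 continuous_on_exp_fst])
  have "abs_L2 (resolvent_source z (rep_L2 g)) = freq 1 *\<^sub>C abs_L2 (\<lambda>p. rep_L2 g p * ?E p)"
    unfolding abs_L2_scaleC[OF sq] resolvent_source_def[abs_def] ..
  moreover have "norm (abs_L2 (\<lambda>p. rep_L2 g p * ?E p)) \<le> exp_bound z * norm (abs_L2 (rep_L2 g))"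
    by (rule norm_abs_L2_mult_le[OF square_integrable_rep_L2 continuous_on_exp_fst norm_exp_freq_le(2)])
  ultimately show ?thesis
    by (simp add: norm_scaleC mult.assoc mult_left_mono)
qed

lemma norm_defect_le: "norm (defect_L2 z g) \<le> cmod (freq 1) * exp_bound z * norm g"
  unfolding defect_L2_def
  using norm_abs_L2_prim_le(2)[OF square_integrable_source_rep] norm_source_le by (rule order.trans)

lemma norm_sol_le:
  "norm (sol_L2 z a g) \<le> exp_bound z * (norm a + cmod (freq 1) * exp_bound z * norm g)"
proof -
  note s = square_integrable_source_rep[of z g]
  note sa = square_integrable_snd[OF square_integrable_rep_L2[of a]]
  have "norm (sol_L2 z a g) \<le>
      exp_bound z * norm (abs_L2 (\<lambda>p. rep_L2 a (snd p) + prim (resolvent_source z (rep_L2 g)) p))"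
    unfolding sol_L2_def resolvent_solution_def[abs_def]
    by (rule norm_abs_L2_mult_le[OF square_integrable_add[OF sa square_integrable_prim[OF s]]
          continuous_on_exp_fst norm_exp_freq_le(1)])
  also have "\<dots> \<le> exp_bound z * (norm (abs_L2 (\<lambda>p::real \<times> real. rep_L2 a (snd p))) +
      norm (abs_L2 (prim (resolvent_source z (rep_L2 g)))))"
    unfolding abs_L2_add[OF sa square_integrable_prim[OF s], symmetric]
    by (intro mult_left_mono norm_triangle_ineq) (simp add: exp_bound_def)
  also have "\<dots> \<le> exp_bound z * (norm a + cmod (freq 1) * exp_bound z * norm g)"
    using norm_abs_L2_snd[OF square_integrable_rep_L2[of a]]
      order.trans[OF norm_abs_L2_prim_le(1)[OF s] norm_source_le]
    by (intro mult_left_mono add_mono) (simp_all add: exp_bound_def)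
  finally show ?thesis .
qed

text \<open>Solving the formula for \<open>a\<close> expresses it through the solution and a
  primitive on the square. As \<open>a\<close> does not depend on x, its norm over the square equals
  its norm over the interval, so the boundary value is bounded by norms over the square.\<close>

lemma norm_initial_le:
  "norm a \<le> exp_bound z * norm (sol_L2 z a g) + cmod (freq 1) * exp_bound z * norm g"
proof -
  note s = square_integrable_source_rep[of z g]
  note sa = square_integrable_snd[OF square_integrable_rep_L2[of a]]
  let ?E = "\<lambda>p::real \<times> real. exp (- freq z * of_real (fst p))"
  let ?s = "resolvent_solution z (rep_L2 a) (rep_L2 g)"
  have sE: "square_integrable (\<lambda>p. ?s p * ?E p)"
    by (rule square_integrable_mult_continuous[OF square_integrable_solution_rep continuous_on_exp_fst])
  have "rep_L2 a (snd p) = ?s p * ?E p - prim (resolvent_source z (rep_L2 g)) p" for p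
  proof -
    have "?s p * ?E p = (rep_L2 a (snd p) + prim (resolvent_source z (rep_L2 g)) p) *
        (?E p * exp (freq z * of_real (fst p)))"
      unfolding resolvent_solution_def by (simp only: ac_simps)
    then show ?thesis unfolding exp_freq_cancel by simp
  qed
  then have "(\<lambda>p::real \<times> real. rep_L2 a (snd p)) = (\<lambda>p. ?s p * ?E p - prim (resolvent_source z (rep_L2 g)) p)"
    by (rule ext)
  then have "norm a = norm (abs_L2 (\<lambda>p. ?s p * ?E p) - abs_L2 (prim (resolvent_source z (rep_L2 g))))"
    using norm_abs_L2_snd[OF square_integrable_rep_L2[of a]] abs_L2_diff[OF sE square_integrable_prim[OF s]] by simp
  also have "\<dots> \<le> norm (abs_L2 (\<lambda>p. ?s p * ?E p)) + norm (abs_L2 (prim (resolvent_source z (rep_L2 g))))"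
    by (rule norm_triangle_ineq4)
  also have "\<dots> \<le> exp_bound z * norm (sol_L2 z a g) + cmod (freq 1) * exp_bound z * norm g"
    unfolding sol_L2_def
    by (intro add_mono norm_abs_L2_mult_le[OF square_integrable_solution_rep continuous_on_exp_fst norm_exp_freq_le(2)]
        order.trans[OF norm_abs_L2_prim_le(1)[OF s] norm_source_le])
  finally show ?thesis .
qed

lemma defect_surj:
  "\<exists>g. defect_L2 z g = h \<and> norm g \<le> exp_bound z / cmod (freq 1) * norm h"
proof -
  let ?E = "\<lambda>p::real \<times> real. exp (freq z * of_real (fst p))"
  \<comment> \<open>Chosen so that, after division by \<open>freq 1\<close>, the source equals h(y)
    for all x; its integral over the interval of length 1 is again h(y).\<close>
  define G where "G = (\<lambda>p::real \<times> real. rep_L2 h (snd p) * ?E p)"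
  have sh: "square_integrable (\<lambda>p::real \<times> real. rep_L2 h (snd p))"
    by (rule square_integrable_snd[OF square_integrable_rep_L2])
  have G: "square_integrable G"
    unfolding G_def by (rule square_integrable_mult_continuous[OF sh continuous_on_exp_fst])
  have G': "square_integrable (\<lambda>p. (1 / freq 1) * G p)"
    by (rule square_integrable_scaleC[OF G])
  define g where "g = (1 / freq 1) *\<^sub>C abs_L2 G"
  have g: "g = abs_L2 (\<lambda>p. (1 / freq 1) * G p)"
    unfolding g_def by (rule abs_L2_scaleC[OF G])
  have "AE p in U\<^sub>2. resolvent_source z (rep_L2 g) p = rep_L2 h (snd p)"
    using AE_rep_L2_abs_L2[OF G', folded g]
  proof eventually_elim
    case (elim p)
    have "resolvent_source z (rep_L2 g) p =
        (freq 1 * (1 / freq 1)) * rep_L2 h (snd p) * (exp (- freq z * of_real (fst p)) * ?E p)"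
      unfolding resolvent_source_def elim G_def by (simp only: ac_simps)
    then show ?case unfolding exp_freq_cancel using freq_1_nonzero by simp
  qed
  from AE_slice_eq[OF square_integrable_source_rep sh this]
  have "AE y in U\<^sub>1. prim (resolvent_source z (rep_L2 g)) (1, y) = rep_L2 h y"
    using AE_square_integrable_slice[OF square_integrable_source_rep[of z g]]
  proof eventually_elim
    case (elim y)
    have "prim (resolvent_source z (rep_L2 g)) (1, y) = (\<integral>t. resolvent_source z (rep_L2 g) (t, y) \<partial>U\<^sub>1)"
      unfolding prim_def by (intro Bochner_Integration.integral_cong) auto
    also have "\<dots> = (\<integral>t. rep_L2 h y \<partial>U\<^sub>1)"
      using elim unfolding square_integrable_def by (intro integral_cong_AE) auto
    finally show ?case by simp
  qed
  then have "defect_L2 z g = abs_L2 (rep_L2 h)"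
    unfolding defect_L2_def abs_L2_eq_iff[OF square_integrable_defect square_integrable_rep_L2] .
  moreover have "norm (abs_L2 G) \<le> exp_bound z * norm h"
    using norm_abs_L2_mult_le[OF sh continuous_on_exp_fst norm_exp_freq_le(1), of z]
    unfolding norm_abs_L2_snd[OF square_integrable_rep_L2] G_def by simp
  then have "norm g \<le> exp_bound z / cmod (freq 1) * norm h"
    unfolding g_def norm_scaleC using freq_1_nonzero by (simp add: norm_divide field_simps)
  ultimately show ?thesis by auto
qed

section \<open>Transfer of resolvent points between \<open>P_ext V\<close> and
  \<open>V\<close>\<close>

lemma P_ext_resolvent_if:
  assumes m: "exp (freq z) \<in> resolvent_set (UNIV, V)"
  shows "z \<in> resolvent_set (P_ext V)"
proof -
  let ?m = "exp (freq z)" and ?D = "fst (P_ext V)" and ?T = "\<lambda>f. snd (P_ext V) f - z *\<^sub>C f"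
  obtain B where bij: "bij (\<lambda>a. V a - ?m *\<^sub>C a)" and B: "\<And>a. norm a \<le> B * norm (V a - ?m *\<^sub>C a)"
    using m unfolding resolvent_set_def by auto
  have "bij_betw ?T ?D UNIV"
    unfolding bij_betw_def
  proof
    show "inj_on ?T ?D"
    proof (rule inj_onI)
      fix f f' assume "f \<in> ?D" "f' \<in> ?D" "?T f = ?T f'"
      then obtain a a' where "f = sol_L2 z a (?T f')" "f' = sol_L2 z a' (?T f')"
          "V a - ?m *\<^sub>C a = V a' - ?m *\<^sub>C a'"
        using P_ext_eq_iff[of f V z "?T f'"] P_ext_eq_iff[of f' V z "?T f'"] by auto
      then show "f = f'"
        using injD[OF bij_is_inj[OF bij], of a a'] by simp
    qed
    show "?T ` ?D = UNIV"
    proof (intro equalityI subset_UNIV subsetI)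
      fix g
      obtain a where "V a - ?m *\<^sub>C a = ?m *\<^sub>C defect_L2 z g"
        using surjD[OF bij_is_surj[OF bij], of "?m *\<^sub>C defect_L2 z g"] by metis
      then have *: "sol_L2 z a g \<in> ?D \<and> ?T (sol_L2 z a g) = g"
        unfolding P_ext_eq_iff by blast
      show "g \<in> ?T ` ?D"
        using * by (intro image_eqI[of _ _ "sol_L2 z a g"]) (simp_all only:)
    qed
  qed
  moreover have "norm f \<le> (exp_bound z * (\<bar>B\<bar> * (cmod ?m * (cmod (freq 1) * exp_bound z)) +
      cmod (freq 1) * exp_bound z)) * norm (?T f)" if "f \<in> ?D" for f
  proof -
    define g where "g = ?T f"
    have "f \<in> ?D \<and> ?T f = g" using that unfolding g_def by simp
    then obtain a where f: "f = sol_L2 z a g" and a: "V a - ?m *\<^sub>C a = ?m *\<^sub>C defect_L2 z g"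
      unfolding P_ext_eq_iff by blast
    have "norm a \<le> B * norm (?m *\<^sub>C defect_L2 z g)"
      using B[of a] unfolding a .
    \<comment> \<open>The resolvent set only provides some real \<open>B\<close>; the absolute value
      secures the sign needed for monotonicity.\<close>
    also have "\<dots> \<le> \<bar>B\<bar> * (cmod ?m * norm (defect_L2 z g))"
      unfolding norm_scaleC by (intro mult_right_mono) auto
    also have "\<dots> \<le> \<bar>B\<bar> * (cmod ?m * (cmod (freq 1) * exp_bound z * norm g))"
      by (intro mult_left_mono norm_defect_le) auto
    finally have "norm a \<le> \<bar>B\<bar> * (cmod ?m * (cmod (freq 1) * exp_bound z * norm g))" .
    then have "norm f \<le> exp_bound z * (\<bar>B\<bar> * (cmod ?m * (cmod (freq 1) * exp_bound z * norm g)) +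
        cmod (freq 1) * exp_bound z * norm g)"
      unfolding f by (intro order.trans[OF norm_sol_le] mult_left_mono add_right_mono) (auto simp: exp_bound_def)
    then show ?thesis unfolding g_def[symmetric] by (simp only: distrib_left distrib_right mult.assoc)
  qed
  ultimately show ?thesis
    unfolding resolvent_set_def case_prod_beta by blast
qed

lemma P_ext_resolvent_only_if:
  assumes z: "z \<in> resolvent_set (P_ext V)"
  shows "exp (freq z) \<in> resolvent_set (UNIV, V)"
proof -
  let ?m = "exp (freq z)" and ?D = "fst (P_ext V)" and ?T = "\<lambda>f. snd (P_ext V) f - z *\<^sub>C f"
  have m0: "?m \<noteq> 0" by simp
  obtain B where bij: "bij_betw ?T ?D UNIV" and B: "\<And>f. f \<in> ?D \<Longrightarrow> norm f \<le> B * norm (?T f)"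
    using z unfolding resolvent_set_def case_prod_beta by auto
  \<comment> \<open>Since an exponential is never zero, every right-hand side for V - \<mu> comes
    from some \<open>g\<close> of controlled norm; this turns each question about V - \<mu> into one
    about \<open>P_ext V\<close>.\<close>
  have lift: "\<exists>g. ?m *\<^sub>C defect_L2 z g = w \<and> norm g \<le> exp_bound z / cmod (freq 1) * norm ((1 / ?m) *\<^sub>C w)" for w
    using defect_surj[of z "(1 / ?m) *\<^sub>C w"] scaleC_inverse(1)[OF m0, of w] by metis
  have "bij (\<lambda>a. V a - ?m *\<^sub>C a)"
  proof (rule bijI)
    show "inj (\<lambda>a. V a - ?m *\<^sub>C a)"
    proof (rule injI)
      fix a b assume eq: "V a - ?m *\<^sub>C a = V b - ?m *\<^sub>C b"
      \<comment> \<open>The same \<open>g\<close> serves \<open>a\<close> and \<open>b\<close>, so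
        both yield solutions of one equation; these coincide, and their boundary value at 0 returns
        the two initial values.\<close>
      obtain g where g: "?m *\<^sub>C defect_L2 z g = V a - ?m *\<^sub>C a" using lift by metis
      have "sol_L2 z a g \<in> ?D \<and> ?T (sol_L2 z a g) = g" "sol_L2 z b g \<in> ?D \<and> ?T (sol_L2 z b g) = g"
        unfolding P_ext_eq_iff using g eq by metis+
      then have "sol_L2 z a g = sol_L2 z b g"
        using inj_onD[OF bij_betw_imp_inj_on[OF bij]] by metis
      then have "boundary_value 0 (sol_L2 z a g) = boundary_value 0 (sol_L2 z b g)"
        by (rule arg_cong)
      then show "a = b"
        by (simp only: boundary_value_sol_0)
    qed
    show "surj (\<lambda>a. V a - ?m *\<^sub>C a)"
      unfolding surj_def
    proof
      fix w
      obtain g where g: "?m *\<^sub>C defect_L2 z g = w" using lift by metis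
      have "g \<in> ?T ` ?D"
        unfolding bij_betw_imp_surj_on[OF bij] by (rule UNIV_I)
      then obtain f where "g = ?T f" "f \<in> ?D" by (rule imageE)
      then have "f \<in> ?D \<and> ?T f = g" by simp
      then obtain a where "V a - ?m *\<^sub>C a = ?m *\<^sub>C defect_L2 z g"
        unfolding P_ext_eq_iff by blast
      with g show "\<exists>a. w = V a - ?m *\<^sub>C a" by metis
    qed
  qed
  moreover have "norm a \<le> ((exp_bound z * \<bar>B\<bar> + cmod (freq 1) * exp_bound z) *
      (exp_bound z / cmod (freq 1) * cmod (1 / ?m))) * norm (V a - ?m *\<^sub>C a)" for a
  proof -
    define w where "w = V a - ?m *\<^sub>C a"
    obtain g where g: "?m *\<^sub>C defect_L2 z g = w"
        "norm g \<le> exp_bound z / cmod (freq 1) * norm ((1 / ?m) *\<^sub>C w)"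
      using lift by metis
    have "sol_L2 z a g \<in> ?D \<and> ?T (sol_L2 z a g) = g"
      unfolding P_ext_eq_iff using g(1) w_def by metis
    then have "norm (sol_L2 z a g) \<le> B * norm g" using B[of "sol_L2 z a g"] by simp
    also have "\<dots> \<le> \<bar>B\<bar> * norm g" by (intro mult_right_mono) auto
    finally have "norm a \<le> exp_bound z * (\<bar>B\<bar> * norm g) + cmod (freq 1) * exp_bound z * norm g"
      by (intro order.trans[OF norm_initial_le[of a z g]] add_right_mono mult_left_mono) (auto simp: exp_bound_def)
    also have "\<dots> = (exp_bound z * \<bar>B\<bar> + cmod (freq 1) * exp_bound z) * norm g"
      by (simp only: distrib_right mult.assoc)
    also have "\<dots> \<le> (exp_bound z * \<bar>B\<bar> + cmod (freq 1) * exp_bound z) *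
        (exp_bound z / cmod (freq 1) * norm ((1 / ?m) *\<^sub>C w))"
      by (intro mult_left_mono g(2)) (auto simp: exp_bound_def)
    finally show ?thesis unfolding w_def norm_scaleC by (simp only: mult.assoc)
  qed
  ultimately show ?thesis
    unfolding resolvent_set_def by blast
qed

theorem theorem1p3:
  fixes V :: "real L2 \<Rightarrow> real L2"
  assumes "unitary V"
  shows "spectrum (P_ext V) = complex_of_real ` {l. e l \<in> spectrum (UNIV, V)}"
proof -
  have iff: "z \<in> spectrum (P_ext V) \<longleftrightarrow> exp (freq z) \<in> spectrum (UNIV, V)" for z
    unfolding spectrum_def using P_ext_resolvent_if P_ext_resolvent_only_if by blast
  have e: "exp (freq (of_real l)) = e l" for l
    by (simp add: freq_def e_def)
  have real: "z \<in> \<real>" if "exp (freq z) \<in> spectrum (UNIV, V)" for z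
  proof -
    have "cmod (exp (freq z)) = 1"
      using that resolvent_set_unitary[OF assms] unfolding spectrum_def by blast
    \<comment> \<open>The real part of i 2 \<pi> z is - 2 \<pi> Im z, so modulus 1 forces Im z =
      0.\<close>
    then have "Im z = 0" by (simp add: norm_exp_eq_Re freq_def)
    then show ?thesis by (simp add: complex_is_Real_iff)
  qed
  show ?thesis
  proof (intro equalityI subsetI)
    fix z assume "z \<in> spectrum (P_ext V)"
    then have z: "exp (freq z) \<in> spectrum (UNIV, V)" by (simp only: iff)
    then obtain l where "z = of_real l" using real[OF z] by (auto elim: Reals_cases)
    with z show "z \<in> complex_of_real ` {l. e l \<in> spectrum (UNIV, V)}" by (simp add: e)
  next
    fix z assume "z \<in> complex_of_real ` {l. e l \<in> spectrum (UNIV, V)}"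
    then show "z \<in> spectrum (P_ext V)" by (auto simp: iff e)
  qed
qed

end
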